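(* Let $L$ be a Lie superalgebra such that $L/Z(L)$ is finitely generated. If $\dim L^2=(r\mid s)$ (with $r,s$ finite), then $L$ is isoclinic to a finite dimensional Lie superalgebra.
   Context: All vector superspaces are over a field $\mathbb{F}$ of characteristic different from $2$ and $3$. A Lie superalgebra is a $\mathbb{Z}_2$-graded vector space $L=L_{\bar 0}\oplus L_{\bar 1}$ with a bilinear bracket satisfying, for homogeneous elements, $[L_\alpha,L_\beta]\subseteq L_{\alpha+\beta}$, $[x,y]=-(-1)^{|x||y|}[y,x]$, and $(-1)^{|x||z|}[x,[y,z]]+(-1)^{|y||x|}[y,[z,x]]+(-1)^{|z||y|}[z,[x,y]]=0$. A homomorphism of Lie superalgebras is a bracket-preserving linear map of even degree (preserving the grading). $L^2=[L,L]$ is the span of all $[x,y]$, $x,y\in L$, and $Z(L)=\{z\in L: [z,x]=0 \text{ for all } x\in L\}$. $\dim L^2=(r\mid s)$ means the even part of $L^2$ has dimension $r$ and the odd part has dimension $s$. Finitely generated means generated, as a Lie superalgebra, by finitely many homogeneous elements. Two Lie superalgebras $L$ and $K$ are isoclinic if there are Lie superalgebra isomorphisms $\alpha: L/Z(L)\to K/Z(K)$ and $\beta: L^2\to K^2$ that are compatible: $\beta([l,m])=[k,r]$ whenever $l,m\in L$, $k,r\in K$ with $k+Z(K)=\alpha(l+Z(L))$ and $r+Z(K)=\alpha(m+Z(L))$. *)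

theory Defs
  imports "Jordan_Normal_Form.Missing_VectorSpace" "HOL-Algebra.AbelCoset" "HOL-Library.Z2"
begin

(* The ring operations mult and one inherited from the module record play no role. *)
record ('f, 'a) lie_superalgebra = "('f, 'a) module" +
  bracket :: "'a \<Rightarrow> 'a \<Rightarrow> 'a"  (\<open>\<lbrakk>_, _\<rbrakk>\<index>\<close>)
  grade :: "bit \<Rightarrow> 'a set"

(* The sign (-1)^(ab), where the type bit is the field with two elements. *)
definition ksign :: "('f, 'm) ring_scheme \<Rightarrow> bit \<Rightarrow> bit \<Rightarrow> 'f" where
  "ksign F a b = (if a * b = 1 then \<ominus>\<^bsub>F\<^esub> \<one>\<^bsub>F\<^esub> else \<one>\<^bsub>F\<^esub>)"

locale lie_superalgebra = vectorspace F L
  for F :: "('f, 'm) ring_scheme" and L :: "('f, 'a, 'x) lie_superalgebra_scheme" (structure) +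
  assumes grade_subspace: "subspace F (grade L d) L"
    and grade_sum: "x \<in> carrier L \<Longrightarrow> \<exists>x0\<in>grade L 0. \<exists>x1\<in>grade L 1. x = x0 \<oplus> x1"
    and grade_Int: "grade L 0 \<inter> grade L 1 = {\<zero>}"
    and bracket_closed: "\<lbrakk>x \<in> carrier L; y \<in> carrier L\<rbrakk> \<Longrightarrow> \<lbrakk>x, y\<rbrakk> \<in> carrier L"
    and bracket_add_left: "\<lbrakk>x \<in> carrier L; y \<in> carrier L; z \<in> carrier L\<rbrakk> \<Longrightarrow>
      \<lbrakk>x \<oplus> y, z\<rbrakk> = \<lbrakk>x, z\<rbrakk> \<oplus> \<lbrakk>y, z\<rbrakk>"
    and bracket_add_right: "\<lbrakk>x \<in> carrier L; y \<in> carrier L; z \<in> carrier L\<rbrakk> \<Longrightarrow>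
      \<lbrakk>x, y \<oplus> z\<rbrakk> = \<lbrakk>x, y\<rbrakk> \<oplus> \<lbrakk>x, z\<rbrakk>"
    and bracket_smult_left: "\<lbrakk>t \<in> carrier F; x \<in> carrier L; y \<in> carrier L\<rbrakk> \<Longrightarrow>
      \<lbrakk>t \<odot> x, y\<rbrakk> = t \<odot> \<lbrakk>x, y\<rbrakk>"
    and bracket_smult_right: "\<lbrakk>t \<in> carrier F; x \<in> carrier L; y \<in> carrier L\<rbrakk> \<Longrightarrow>
      \<lbrakk>x, t \<odot> y\<rbrakk> = t \<odot> \<lbrakk>x, y\<rbrakk>"
    and bracket_grade: "\<lbrakk>x \<in> grade L a; y \<in> grade L b\<rbrakk> \<Longrightarrow> \<lbrakk>x, y\<rbrakk> \<in> grade L (a + b)"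
    and bracket_skew: "\<lbrakk>x \<in> grade L a; y \<in> grade L b\<rbrakk> \<Longrightarrow>
      \<lbrakk>x, y\<rbrakk> = \<ominus> (ksign F a b \<odot> \<lbrakk>y, x\<rbrakk>)"
    and jacobi: "\<lbrakk>x \<in> grade L a; y \<in> grade L b; z \<in> grade L c\<rbrakk> \<Longrightarrow>
      ksign F a c \<odot> \<lbrakk>x, \<lbrakk>y, z\<rbrakk>\<rbrakk> \<oplus> ksign F b a \<odot> \<lbrakk>y, \<lbrakk>z, x\<rbrakk>\<rbrakk> \<oplus> ksign F c b \<odot> \<lbrakk>z, \<lbrakk>x, y\<rbrakk>\<rbrakk> = \<zero>"

definition lie_superalgebra_iso ::
  "('f, 'm) ring_scheme \<Rightarrow> ('f, 'a, 'x) lie_superalgebra_scheme \<Rightarrow>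
    ('f, 'b, 'y) lie_superalgebra_scheme \<Rightarrow> ('a \<Rightarrow> 'b) set" where
  "lie_superalgebra_iso F L K = {f. mod_hom F L K f
     \<and> (\<forall>x\<in>carrier L. \<forall>y\<in>carrier L. f (\<lbrakk>x, y\<rbrakk>\<^bsub>L\<^esub>) = \<lbrakk>f x, f y\<rbrakk>\<^bsub>K\<^esub>)
     \<and> (\<forall>d. f ` grade L d \<subseteq> grade K d)
     \<and> bij_betw f (carrier L) (carrier K)}"

definition sub_superalgebra ::
  "('f, 'm) ring_scheme \<Rightarrow> ('f, 'a, 'x) lie_superalgebra_scheme \<Rightarrow> 'a set \<Rightarrow> bool" where
  "sub_superalgebra F L N \<longleftrightarrow> subspace F N L
     \<and> (\<forall>x\<in>N. \<exists>x0\<in>N \<inter> grade L 0. \<exists>x1\<in>N \<inter> grade L 1. x = x0 \<oplus>\<^bsub>L\<^esub> x1)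
     \<and> (\<forall>x\<in>N. \<forall>y\<in>N. \<lbrakk>x, y\<rbrakk>\<^bsub>L\<^esub> \<in> N)"

definition finitely_generated ::
  "('f, 'm) ring_scheme \<Rightarrow> ('f, 'a, 'x) lie_superalgebra_scheme \<Rightarrow> bool" where
  "finitely_generated F L \<longleftrightarrow> (\<exists>S. finite S \<and> S \<subseteq> grade L 0 \<union> grade L 1
     \<and> \<Inter>{N. sub_superalgebra F L N \<and> S \<subseteq> N} = carrier L)"

definition center :: "('f, 'a, 'x) lie_superalgebra_scheme \<Rightarrow> 'a set" where
  "center L = {z \<in> carrier L. \<forall>x\<in>carrier L. \<lbrakk>z, x\<rbrakk>\<^bsub>L\<^esub> = \<zero>\<^bsub>L\<^esub>}"

(* Operations on cosets in the style of rcoset_mult; meaningful when I is a graded ideal. *)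
definition quotient_superalgebra ::
  "('f, 'a, 'x) lie_superalgebra_scheme \<Rightarrow> 'a set \<Rightarrow> ('f, 'a set) lie_superalgebra" where
  "quotient_superalgebra L I = \<lparr>carrier = a_rcosets\<^bsub>L\<^esub> I, mult = undefined, one = undefined,
     zero = I, add = set_add L,
     smult = (\<lambda>c X. \<Union>x\<in>X. I +>\<^bsub>L\<^esub> (c \<odot>\<^bsub>L\<^esub> x)),
     bracket = (\<lambda>X Y. \<Union>x\<in>X. \<Union>y\<in>Y. I +>\<^bsub>L\<^esub> \<lbrakk>x, y\<rbrakk>\<^bsub>L\<^esub>),
     grade = (\<lambda>d. (\<lambda>x. I +>\<^bsub>L\<^esub> x) ` grade L d)\<rparr>"

definition derived ::
  "('f, 'm) ring_scheme \<Rightarrow> ('f, 'a, 'x) lie_superalgebra_scheme \<Rightarrow>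
    ('f, 'a, 'x) lie_superalgebra_scheme" where
  "derived F L = (let D = LinearCombinations.module.span F L
       {\<lbrakk>x, y\<rbrakk>\<^bsub>L\<^esub> | x y. x \<in> carrier L \<and> y \<in> carrier L}
     in L\<lparr>carrier := D, grade := (\<lambda>d. D \<inter> grade L d)\<rparr>)"

(* vectorspace.dim carries information only together with vectorspace.fin_dim. *)
definition has_superdim ::
  "('f, 'm) ring_scheme \<Rightarrow> ('f, 'a, 'x) lie_superalgebra_scheme \<Rightarrow> nat \<Rightarrow> nat \<Rightarrow> bool" where
  "has_superdim F L r s \<longleftrightarrow>
     vectorspace.fin_dim F (L\<lparr>carrier := grade L 0\<rparr>)
     \<and> vectorspace.dim F (L\<lparr>carrier := grade L 0\<rparr>) = r
     \<and> vectorspace.fin_dim F (L\<lparr>carrier := grade L 1\<rparr>)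
     \<and> vectorspace.dim F (L\<lparr>carrier := grade L 1\<rparr>) = s"

definition isoclinic ::
  "('f, 'm) ring_scheme \<Rightarrow> ('f, 'a, 'x) lie_superalgebra_scheme \<Rightarrow>
    ('f, 'b, 'y) lie_superalgebra_scheme \<Rightarrow> bool" where
  "isoclinic F L K \<longleftrightarrow>
     (\<exists>\<alpha>\<in>lie_superalgebra_iso F (quotient_superalgebra L (center L)) (quotient_superalgebra K (center K)).
      \<exists>\<beta>\<in>lie_superalgebra_iso F (derived F L) (derived F K).
        \<forall>l\<in>carrier L. \<forall>m\<in>carrier L. \<forall>k\<in>carrier K. \<forall>r\<in>carrier K.
          center K +>\<^bsub>K\<^esub> k = \<alpha> (center L +>\<^bsub>L\<^esub> l) \<and> center K +>\<^bsub>K\<^esub> r = \<alpha> (center L +>\<^bsub>L\<^esub> m)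
          \<longrightarrow> \<beta> (\<lbrakk>l, m\<rbrakk>\<^bsub>L\<^esub>) = \<lbrakk>k, r\<rbrakk>\<^bsub>K\<^esub>)"

end

(* Only finitely many conditions [z, s] = 0, one for each generator s of L/Z(L), have to hold
   for a homogeneous z to be central, and each of them cuts out a subspace of finite codimension
   because [L, s] lies in the finite-dimensional L^2.  Hence L/Z(L) is finite-dimensional.
   Homogeneous representatives of a basis of L/Z(L) together with L^2 span a finite-dimensional
   graded subalgebra C with L = C + Z(L).  Then C^2 = L^2 and Z(C) = C \<inter> Z(L), so the inclusion
   of C into L induces an isoclinism.  Coordinates finally carry C to functions on the naturals. *)
theory Submission
  imports Defs
begin

section \<open>Modules and linear maps\<close>

text \<open>Skew-symmetry and the Jacobi identity are available for homogeneous elements only, and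
  this shapes the argument. A centralizer is shown to be a graded subalgebra only for a homogeneous
  element, so centrality is tested one degree at a time and every spanning set is chosen inside the
  two degrees. For the same reason the center, defined by left brackets alone, has to be shown
  graded before it also annihilates from the right. The generators live in \<open>L/Z(L)\<close>;
  lifts to \<open>L\<close> suffice because a bracket does not change when central elements are
  added to its arguments. That invariance also explains why a possibly infinite-dimensional center
  does no harm: isoclinism sees only the central quotient and \<open>L^2\<close>. Adjoining
  \<open>L^2\<close> to the representatives makes their span closed under brackets. Finite
  codimension is expressed by finite spanning sets, without bases or dimension counts. The type
  \<open>nat \<Rightarrow> 'f\<close> has room for every finite coordinate vector over the field and
  does not depend on the type of \<open>L\<close>.\<close>

text \<open>Used with the coset map for the quotient, and with the identity between records that
  agree on the module operations but differ in further fields.\<close>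

lemma module_image:
  assumes M: "module R M"
    and carrier: "carrier N = p ` carrier M"
    and zero: "\<zero>\<^bsub>N\<^esub> = p \<zero>\<^bsub>M\<^esub>"
    and add: "\<And>x y. x \<in> carrier M \<Longrightarrow> y \<in> carrier M \<Longrightarrow> p x \<oplus>\<^bsub>N\<^esub> p y = p (x \<oplus>\<^bsub>M\<^esub> y)"
    and smult: "\<And>c x. c \<in> carrier R \<Longrightarrow> x \<in> carrier M \<Longrightarrow> c \<odot>\<^bsub>N\<^esub> p x = p (c \<odot>\<^bsub>M\<^esub> x)"
  shows "module R N"
proof -
  interpret M: module R M by fact
  have neg: "\<exists>w\<in>carrier M. p (x \<oplus>\<^bsub>M\<^esub> w) = p \<zero>\<^bsub>M\<^esub>" if "x \<in> carrier M" for x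
    using M.M.r_neg[OF that] M.M.a_inv_closed[OF that] by metis
  show ?thesis
    by (rule module_criteria[OF M.R.cring_axioms])
      (auto simp: neg carrier zero add smult M.M.a_ac M.smult_l_distr M.smult_r_distr M.smult_assoc1)
qed

lemma (in module) submodule_minus_closed:
  assumes N: "submodule R N M" and "x \<in> N" "y \<in> N"
  shows "x \<ominus>\<^bsub>M\<^esub> y \<in> N"
proof -
  interpret N: submodule R N M by fact
  have "\<ominus>\<^bsub>M\<^esub> y = (\<ominus> \<one>) \<odot>\<^bsub>M\<^esub> y" using assms N.subset by (simp add: smult_minus_1 subsetD)
  then show ?thesis using assms by (simp add: a_minus_def)
qed

lemma submodule_Int:
  assumes "submodule R A M" "submodule R B M"
  shows "submodule R (A \<inter> B) M"
proof -
  interpret A: submodule R A M by fact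
  interpret B: submodule R B M by fact
  show ?thesis
    by (rule submodule.intro) (use A.subset A.module in auto)
qed

lemma (in module) span_insertE:
  assumes v: "v \<in> span (insert y Y)" and fin: "finite Y" and y: "y \<in> carrier M" and Y: "Y \<subseteq> carrier M"
  obtains c w where "c \<in> carrier R" "w \<in> span Y" "v = c \<odot>\<^bsub>M\<^esub> y \<oplus>\<^bsub>M\<^esub> w"
proof -
  have "span (insert y Y) = submodule_sum (span {y}) (span Y)"
    using span_union_is_sum[of "{y}" Y] y Y by simp
  then obtain u w where u: "u \<in> span {y}" and w: "w \<in> span Y" and v: "v = u \<oplus>\<^bsub>M\<^esub> w"
    using v unfolding submodule_sum_def by auto
  obtain a where a: "a \<in> {y} \<rightarrow> carrier R" "u = lincomb a {y}"
    using finite_in_span[of "{y}" u] u y by auto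
  then have "u = a y \<odot>\<^bsub>M\<^esub> y" using y by (simp add: lincomb_def)
  with a w v that show thesis by auto
qed

text \<open>The kernel of \<open>T\<close> on \<open>Q\<close> has finite codimension because
  \<open>T\<close> maps \<open>Q\<close> into a finitely generated space. Induction removes one
  generator \<open>y\<close>: an element \<open>q0\<close> whose image needs \<open>y\<close> is
  added to \<open>X\<close>, and every other element is corrected by a multiple of \<open>q0\<close>
  until its image avoids \<open>y\<close>. \<open>Q\<close> varies in the induction because it
  shrinks to \<open>Q'\<close>.\<close>

lemma (in linear_map) finite_preimage_generators:
  assumes "finite Y" "Y \<subseteq> carrier W" "submodule K Q V" "T ` Q \<subseteq> W.module.span Y"
  shows "\<exists>X. finite X \<and> X \<subseteq> Q \<and> (\<forall>q\<in>Q. \<exists>x\<in>V.module.span X. T q = T x)"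
  using assms
proof (induction Y arbitrary: Q rule: finite_induct)
  case empty
  have "T q = T \<zero>\<^bsub>V\<^esub>" if "q \<in> Q" for q
    using that empty(3) by (auto simp: W.span_empty)
  then show ?case by (intro exI[of _ "{}"]) (simp add: V.span_empty)
next
  case (insert y Y)
  interpret Q: submodule K Q V by fact
  have QV: "\<And>q. q \<in> Q \<Longrightarrow> q \<in> carrier V" using Q.subset by blast
  have Y: "y \<in> carrier W" "Y \<subseteq> carrier W" using insert.prems by auto
  note spanY = W.module.span_is_submodule[OF Y(2)]
  interpret S: submodule K "W.module.span Y" W by (rule spanY)
  show ?case
  proof (cases "T ` Q \<subseteq> W.module.span Y")
    case True
    then show ?thesis using insert Y by blast
  next
    case False
    then obtain q0 where q0: "q0 \<in> Q" "T q0 \<notin> W.module.span Y" by blast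
    have "T q0 \<in> W.module.span (insert y Y)" using insert.prems q0 by blast
    then obtain c0 w0 where c0: "c0 \<in> carrier K" "w0 \<in> W.module.span Y" "T q0 = c0 \<odot>\<^bsub>W\<^esub> y \<oplus>\<^bsub>W\<^esub> w0"
      using W.module.span_insertE[OF _ insert.hyps(1) Y] by blast
    \<comment> \<open>Otherwise \<open>T q0 = w0\<close> would lie in \<open>span Y\<close>.\<close>
    have nz: "c0 \<noteq> \<zero>\<^bsub>K\<^esub>"
      using c0 q0 Y S.subset by auto
    define Q' where "Q' = {q \<in> Q. T q \<in> W.module.span Y}"
    have "submodule K Q' V"
      by (rule submodule.intro) (use Q.subset in \<open>auto simp: Q'_def QV Q.module\<close>)
    moreover have "T ` Q' \<subseteq> W.module.span Y" by (auto simp: Q'_def)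
    ultimately obtain X where X: "finite X" "X \<subseteq> Q'" "\<And>q. q \<in> Q' \<Longrightarrow> \<exists>x\<in>V.module.span X. T q = T x"
      using insert.IH[OF Y(2)] by metis
    have XV: "X \<subseteq> carrier V" using X(2) QV by (auto simp: Q'_def)
    have q0V: "insert q0 X \<subseteq> carrier V" using XV q0 QV by auto
    interpret SX: submodule K "V.module.span (insert q0 X)" V by (rule V.module.span_is_submodule[OF q0V])
    have "\<exists>x\<in>V.module.span (insert q0 X). T q = T x" if q: "q \<in> Q" for q
    proof -
      have "T q \<in> W.module.span (insert y Y)" using insert.prems q by blast
      then obtain c w where c: "c \<in> carrier K" "w \<in> W.module.span Y" "T q = c \<odot>\<^bsub>W\<^esub> y \<oplus>\<^bsub>W\<^esub> w"
        using W.module.span_insertE[OF _ insert.hyps(1) Y] by blast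
      \<comment> \<open>With this ratio of coefficients the \<open>y\<close>-terms of
        \<open>T q\<close> and of \<open>T\<close> applied to \<open>t\<close> times
        \<open>q0\<close> cancel, so that the difference \<open>?q\<close> lies in
        \<open>Q'\<close>.\<close>
      define t where "t = c \<otimes>\<^bsub>K\<^esub> inv\<^bsub>K\<^esub> c0"
      have inv: "inv\<^bsub>K\<^esub> c0 \<in> carrier K" "inv\<^bsub>K\<^esub> c0 \<otimes>\<^bsub>K\<^esub> c0 = \<one>\<^bsub>K\<^esub>"
        using nz c0 V.field.field_Units by auto
      have t: "t \<in> carrier K" "t \<otimes>\<^bsub>K\<^esub> c0 = c"
        using c c0 inv by (auto simp: t_def V.module.R.m_assoc)
      let ?q = "q \<ominus>\<^bsub>V\<^esub> t \<odot>\<^bsub>V\<^esub> q0"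
      have cW: "w \<in> carrier W" "w0 \<in> carrier W" "y \<in> carrier W" using c c0 S.subset Y by auto
      have "T (t \<odot>\<^bsub>V\<^esub> q0) = c \<odot>\<^bsub>W\<^esub> y \<oplus>\<^bsub>W\<^esub> t \<odot>\<^bsub>W\<^esub> w0"
        using t c0 q0 QV cW by (simp add: W.module.smult_r_distr W.module.smult_assoc1[symmetric])
      then have "T ?q = (c \<odot>\<^bsub>W\<^esub> y \<oplus>\<^bsub>W\<^esub> w) \<ominus>\<^bsub>W\<^esub> (c \<odot>\<^bsub>W\<^esub> y \<oplus>\<^bsub>W\<^esub> t \<odot>\<^bsub>W\<^esub> w0)"
        using q q0 QV t c by simp
      also have "\<dots> = w \<ominus>\<^bsub>W\<^esub> t \<odot>\<^bsub>W\<^esub> w0"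
        using cW t c by (simp add: a_minus_def W.module.M.minus_add W.module.M.a_ac W.module.M.r_neg2)
      also have "\<dots> \<in> W.module.span Y"
        using W.module.submodule_minus_closed[OF spanY] c c0 t by simp
      finally have "?q \<in> Q'"
        using V.module.submodule_minus_closed[OF insert.prems(2)] q q0 t by (simp add: Q'_def)
      then obtain x where x: "x \<in> V.module.span X" "T ?q = T x" using X(3) by blast
      have xV: "x \<in> carrier V" "x \<in> V.module.span (insert q0 X)"
        using x XV V.module.span_is_monotone[of X "insert q0 X"] V.module.span_is_subset2[OF XV] by auto
      have q0s: "q0 \<in> V.module.span (insert q0 X)" using V.module.in_own_span[OF q0V] by blast
      have "T q = T (?q \<oplus>\<^bsub>V\<^esub> t \<odot>\<^bsub>V\<^esub> q0)"
        using q q0 QV t by (simp add: a_minus_def V.module.M.a_assoc V.module.M.l_neg)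
      also have "\<dots> = T (x \<oplus>\<^bsub>V\<^esub> t \<odot>\<^bsub>V\<^esub> q0)"
        using q q0 QV t xV x by simp
      finally show ?thesis using xV q0s t by (intro bexI[of _ "x \<oplus>\<^bsub>V\<^esub> t \<odot>\<^bsub>V\<^esub> q0"]) auto
    qed
    then show ?thesis
      using X q0 by (intro exI[of _ "insert q0 X"]) (auto simp: Q'_def)
  qed
qed

section \<open>Center and central quotient\<close>

context lie_superalgebra
begin

lemma submodule_grade: "submodule F (grade L d) L"
  using grade_subspace by (simp add: subspace_def)

lemma grade_closed: "x \<in> grade L d \<Longrightarrow> x \<in> carrier L"
  using submodule.subset[OF submodule_grade] by blast

lemma grade_decomp:
  assumes "x \<in> carrier L"
  obtains x0 x1 where "x0 \<in> grade L 0" "x1 \<in> grade L 1" "x = x0 \<oplus> x1"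
  using grade_sum[OF assms] by blast

lemma bracket_zero_left [simp]: "x \<in> carrier L \<Longrightarrow> \<lbrakk>\<zero>, x\<rbrakk> = \<zero>"
  using bracket_smult_left[of "\<zero>\<^bsub>F\<^esub>" \<zero> x] by (simp add: bracket_closed)

lemma bracket_zero_right [simp]: "x \<in> carrier L \<Longrightarrow> \<lbrakk>x, \<zero>\<rbrakk> = \<zero>"
  using bracket_smult_right[of "\<zero>\<^bsub>F\<^esub>" x \<zero>] by (simp add: bracket_closed)

lemma ksign_closed [simp]: "ksign F a b \<in> carrier F"
  by (simp add: ksign_def)

lemma ksign_smult_eq_zero: "x \<in> carrier L \<Longrightarrow> ksign F a b \<odot> x = \<zero> \<Longrightarrow> x = \<zero>"
  by (auto simp: ksign_def smult_minus_1 split: if_splits)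

text \<open>Directness of the grading: in \<open>bit\<close> the other degree is
  \<open>1 + a\<close>, and \<open>v\<close>, being the negative of \<open>u\<close>, lies in both
  degrees.\<close>

lemma grade_sum_eq_zero:
  assumes u: "u \<in> grade L a" and v: "v \<in> grade L (1 + a)" and sum: "u \<oplus> v = \<zero>"
  shows "u = \<zero>" "v = \<zero>"
proof -
  note uv = grade_closed[OF u] grade_closed[OF v]
  have "v = \<ominus> u" using sum uv by (metis M.a_comm M.minus_equality)
  also have "\<dots> = \<zero> \<ominus> u" using uv by (simp add: a_minus_def)
  also have "\<dots> \<in> grade L a"
    using submodule_minus_closed[OF submodule_grade _ u] submodule.zero_closed[OF submodule_grade] .
  finally have "v \<in> grade L 0 \<inter> grade L 1" using v by (cases a) (auto simp: one_add_one)
  then show "v = \<zero>" using grade_Int by simp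
  with sum uv show "u = \<zero>" by simp
qed

lemma homogeneous_commute:
  assumes "x \<in> grade L a" "y \<in> grade L b" "\<lbrakk>x, y\<rbrakk> = \<zero>"
  shows "\<lbrakk>y, x\<rbrakk> = \<zero>"
  using bracket_skew[OF assms(2,1)] assms(3) by simp

lemma centerI:
  "z \<in> carrier L \<Longrightarrow> (\<And>x. x \<in> carrier L \<Longrightarrow> \<lbrakk>z, x\<rbrakk> = \<zero>) \<Longrightarrow> z \<in> center L"
  by (simp add: center_def)

lemma centerI_homogeneous:
  assumes z: "z \<in> carrier L"
    and zx: "\<And>x d. x \<in> grade L d \<Longrightarrow> \<lbrakk>z, x\<rbrakk> = \<zero>"
  shows "z \<in> center L"
proof -
  have "\<lbrakk>z, x\<rbrakk> = \<zero>" if "x \<in> carrier L" for x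
    using grade_decomp[OF that] zx z bracket_add_right grade_closed
    by (metis M.r_zero M.zero_closed)
  then show ?thesis using z by (simp add: centerI)
qed

text \<open>The center is graded: against a homogeneous \<open>x\<close> the brackets of
  \<open>z0\<close> and \<open>z1\<close> lie in opposite degrees and sum to zero, hence both
  vanish.\<close>

lemma center_decomp:
  assumes z: "z \<in> center L" and z0: "z0 \<in> grade L 0" and z1: "z1 \<in> grade L 1" and sum: "z = z0 \<oplus> z1"
  shows "z0 \<in> center L" "z1 \<in> center L"
proof -
  note carr = grade_closed[OF z0] grade_closed[OF z1]
  have *: "\<lbrakk>z0, x\<rbrakk> = \<zero> \<and> \<lbrakk>z1, x\<rbrakk> = \<zero>" if x: "x \<in> grade L d" for x d
  proof -
    have "\<lbrakk>z0, x\<rbrakk> \<oplus> \<lbrakk>z1, x\<rbrakk> = \<zero>"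
      using z sum carr grade_closed[OF x] bracket_add_left by (simp add: center_def)
    moreover have "\<lbrakk>z0, x\<rbrakk> \<in> grade L d" using bracket_grade[OF z0 x] unfolding add_0_left .
    ultimately show ?thesis using grade_sum_eq_zero[OF _ bracket_grade[OF z1 x]] by simp
  qed
  from * carr show "z0 \<in> center L" "z1 \<in> center L" by (auto intro!: centerI_homogeneous)
qed

lemma center_closed: "z \<in> center L \<Longrightarrow> z \<in> carrier L"
  by (simp add: center_def)

lemma center_left: "z \<in> center L \<Longrightarrow> x \<in> carrier L \<Longrightarrow> \<lbrakk>z, x\<rbrakk> = \<zero>"
  by (simp add: center_def)

text \<open>Skew-symmetry cannot be applied to \<open>x\<close> and \<open>z\<close> directly. Both
  are split into homogeneous parts, and the parts of \<open>z\<close> are again central.\<close>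

lemma center_right:
  assumes z: "z \<in> center L" and x: "x \<in> carrier L"
  shows "\<lbrakk>x, z\<rbrakk> = \<zero>"
proof -
  obtain z0 z1 where zd: "z0 \<in> grade L 0" "z1 \<in> grade L 1" "z = z0 \<oplus> z1"
    using grade_decomp[OF center_closed[OF z]] .
  obtain x0 x1 where xd: "x0 \<in> grade L 0" "x1 \<in> grade L 1" "x = x0 \<oplus> x1"
    using grade_decomp[OF x] .
  note c = center_decomp[OF z zd]
  have "\<lbrakk>xa, za\<rbrakk> = \<zero>" if "xa \<in> grade L a" "za \<in> grade L b" "za \<in> center L" for xa za a b
    using homogeneous_commute[OF that(2,1)] center_left[OF that(3)] grade_closed[OF that(1)] by blast
  with c zd xd show ?thesis
    by (simp add: bracket_add_left bracket_add_right grade_closed bracket_closed)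
qed

lemma submodule_center: "submodule F (center L) L"
  by (rule submodule.intro)
    (auto simp: center_def bracket_add_left bracket_smult_left module_axioms bracket_closed)

text \<open>For homogeneous \<open>x\<close> and \<open>y\<close> commuting with \<open>z\<close>,
  two of the three Jacobi terms vanish and the third is the bracket of \<open>z\<close> with that of
  \<open>x\<close> and \<open>y\<close>, up to sign. Homogeneity of \<open>z\<close> also makes the
  centralizer graded, since bracketing with \<open>z\<close> shifts both degrees by
  \<open>a\<close>; bilinearity then covers arbitrary \<open>x\<close> and \<open>y\<close>.\<close>

lemma sub_superalgebra_centralizer:
  assumes z: "z \<in> grade L a"
  shows "sub_superalgebra F L {y \<in> carrier L. \<lbrakk>z, y\<rbrakk> = \<zero>}" (is "sub_superalgebra F L ?C")
proof -
  note zc = grade_closed[OF z]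
  have sub: "submodule F ?C L"
    by (rule submodule.intro)
      (auto simp: bracket_add_right bracket_smult_right module_axioms bracket_closed zc)
  have split: "y0 \<in> ?C \<and> y1 \<in> ?C"
    if y: "y0 \<oplus> y1 \<in> ?C" and y0: "y0 \<in> grade L 0" and y1: "y1 \<in> grade L 1" for y0 y1
  proof -
    have "\<lbrakk>z, y0\<rbrakk> \<oplus> \<lbrakk>z, y1\<rbrakk> = \<zero>"
      using y grade_closed[OF y0] grade_closed[OF y1] zc bracket_add_right by simp
    moreover have 0: "\<lbrakk>z, y0\<rbrakk> \<in> grade L a" using bracket_grade[OF z y0] unfolding add_0_right .
    moreover have 1: "\<lbrakk>z, y1\<rbrakk> \<in> grade L (1 + a)"
      using bracket_grade[OF z y1] unfolding add.commute[of a 1] .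
    ultimately show ?thesis
      using grade_sum_eq_zero[OF 0 1] grade_closed[OF y0] grade_closed[OF y1] by simp
  qed
  have hom: "\<lbrakk>x, y\<rbrakk> \<in> ?C"
    if x: "x \<in> ?C" "x \<in> grade L b" and y: "y \<in> ?C" "y \<in> grade L c" for x y b c
  proof -
    have "\<lbrakk>y, z\<rbrakk> = \<zero>" using homogeneous_commute[OF z y(2)] y by simp
    then have "ksign F a c \<odot> \<lbrakk>z, \<lbrakk>x, y\<rbrakk>\<rbrakk> = \<zero>"
      using jacobi[OF x(2) y(2) z] x y zc by (simp add: bracket_closed)
    then show ?thesis using x y zc by (auto simp: bracket_closed intro: ksign_smult_eq_zero)
  qed
  have "\<lbrakk>x, y\<rbrakk> \<in> ?C" if x: "x \<in> ?C" and y: "y \<in> ?C" for x y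
  proof -
    obtain x0 x1 where xd: "x0 \<in> grade L 0" "x1 \<in> grade L 1" "x = x0 \<oplus> x1"
      using grade_decomp x by blast
    obtain y0 y1 where yd: "y0 \<in> grade L 0" "y1 \<in> grade L 1" "y = y0 \<oplus> y1"
      using grade_decomp y by blast
    have xs: "x0 \<in> ?C" "x1 \<in> ?C" using split[OF _ xd(1,2)] xd x by blast+
    have ys: "y0 \<in> ?C" "y1 \<in> ?C" using split[OF _ yd(1,2)] yd y by blast+
    have "\<lbrakk>x, y\<rbrakk> = (\<lbrakk>x0, y0\<rbrakk> \<oplus> \<lbrakk>x1, y0\<rbrakk>) \<oplus> (\<lbrakk>x0, y1\<rbrakk> \<oplus> \<lbrakk>x1, y1\<rbrakk>)"
      using xd yd by (simp add: bracket_add_left bracket_add_right grade_closed bracket_closed)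
    also have "\<dots> \<in> ?C"
      by (intro submodule.m_closed[OF sub] hom[OF xs(1) xd(1) ys(1) yd(1)] hom[OF xs(2) xd(2) ys(1) yd(1)]
          hom[OF xs(1) xd(1) ys(2) yd(2)] hom[OF xs(2) xd(2) ys(2) yd(2)])
    finally show ?thesis .
  qed
  moreover have "\<exists>x0\<in>?C \<inter> grade L 0. \<exists>x1\<in>?C \<inter> grade L 1. x = x0 \<oplus> x1" if "x \<in> ?C" for x
  proof -
    obtain x0 x1 where xd: "x0 \<in> grade L 0" "x1 \<in> grade L 1" "x = x0 \<oplus> x1"
      using grade_decomp \<open>x \<in> ?C\<close> by blast
    then have "x0 \<in> ?C \<and> x1 \<in> ?C" using split[OF _ xd(1,2)] \<open>x \<in> ?C\<close> by blast
    then show ?thesis using xd by blast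
  qed
  ultimately show ?thesis
    using sub vectorspace_axioms by (simp add: sub_superalgebra_def subspace_def)
qed

section \<open>Cosets of the center and the quotient superalgebra\<close>

lemma abelian_subgroup_center: "abelian_subgroup (center L) L"
proof (rule abelian_subgroupI3)
  interpret Z: submodule F "center L" L by (rule submodule_center)
  have "\<ominus> z \<in> center L" if "z \<in> center L" for z
    using submodule_minus_closed[OF submodule_center Z.zero_closed that] center_closed[OF that]
    by (simp add: a_minus_def)
  then have "subgroup (center L) (add_monoid L)"
    using M.add.subgroupI[of "center L"] Z.subset Z.zero_closed Z.m_closed
    by (metis (no_types, lifting) empty_iff a_inv_def)
  then show "additive_subgroup (center L) L" by (rule additive_subgroupI)
  show "abelian_group L" by (rule M.abelian_group_axioms)
qed

sublocale center: abelian_subgroup "center L" L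
  by (rule abelian_subgroup_center)

abbreviation coset :: "'a \<Rightarrow> 'a set" where
  "coset x \<equiv> center L +> x"

abbreviation quotient :: "('f, 'a set) lie_superalgebra" where
  "quotient \<equiv> quotient_superalgebra L (center L)"

lemma coset_memE:
  assumes "y \<in> coset x"
  obtains z where "z \<in> center L" "y = z \<oplus> x"
  using assms by (auto simp: a_r_coset_def')

lemma coset_memI: "z \<in> center L \<Longrightarrow> z \<oplus> x \<in> coset x"
  by (auto simp: a_r_coset_def')

lemma coset_add_center:
  assumes "z \<in> center L" "x \<in> carrier L"
  shows "coset (z \<oplus> x) = coset x"
  using center.a_repr_independence'[OF coset_memI[OF assms(1)] assms(2)] by simp

text \<open>A representative of a homogeneous coset need not be homogeneous. As the center is
  graded, comparing components of degree \<open>d\<close> shows that \<open>l\<close> and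
  \<open>u\<close> differ by a central element. This is what makes the isomorphism of central
  quotients preserve degrees.\<close>

lemma coset_eq_homogeneous_part:
  assumes l: "l \<in> grade L d" and u: "u \<in> grade L d" and v: "v \<in> grade L (1 + d)"
    and z: "z \<in> center L" and eq: "l = z \<oplus> (u \<oplus> v)"
  shows "coset l = coset u"
proof -
  obtain z0 z1 where zd: "z0 \<in> grade L 0" "z1 \<in> grade L 1" "z = z0 \<oplus> z1"
    using grade_decomp[OF center_closed[OF z]] .
  \<comment> \<open>\<open>x\<close> and \<open>y\<close> are \<open>z0\<close> and
    \<open>z1\<close>, ordered so that \<open>x\<close> has the degree of \<open>l\<close>.\<close>
  obtain x y where xy: "x \<in> center L" "x \<in> grade L d" "y \<in> grade L (1 + d)" "z = x \<oplus> y"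
  proof (cases "d = 0")
    case True
    with that[of z0 z1] zd center_decomp[OF z zd] show thesis by simp
  next
    case False
    then have "d = 1" by simp
    with that[of z1 z0] zd center_decomp[OF z zd] show thesis
      by (simp add: M.a_comm grade_closed one_add_one)
  qed
  note carr = grade_closed[OF l] grade_closed[OF u] grade_closed[OF v] grade_closed[OF xy(2)] grade_closed[OF xy(3)]
  have "(x \<oplus> u) \<ominus> l \<in> grade L d"
    using submodule_minus_closed[OF submodule_grade] submodule.m_closed[OF submodule_grade] xy u l by blast
  moreover have "y \<oplus> v \<in> grade L (1 + d)"
    using submodule.m_closed[OF submodule_grade] xy v by blast
  moreover have "((x \<oplus> u) \<ominus> l) \<oplus> (y \<oplus> v) = l \<ominus> l"
    using carr by (simp add: eq xy(4) a_minus_def M.a_ac)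
  ultimately have "(x \<oplus> u) \<ominus> l = \<zero>"
    using grade_sum_eq_zero[of "(x \<oplus> u) \<ominus> l" d "y \<oplus> v"] carr by (simp add: a_minus_def M.r_neg)
  then have "l = x \<oplus> u" using carr by (metis M.a_closed M.add.right_cancel M.a_inv_closed M.r_neg a_minus_def)
  then show ?thesis using coset_add_center xy carr by simp
qed

lemma coset_eqD: "coset x = coset y \<Longrightarrow> x \<in> carrier L \<Longrightarrow> x \<in> coset y"
  using center.a_rcos_self by blast

text \<open>The quotient operations are unions over representatives; a union of equal sets collapses
  to that set only when the index set is nonempty.\<close>

lemma coset_nonempty: "x \<in> carrier L \<Longrightarrow> coset x \<noteq> {}"
  using center.a_rcos_self by blast

lemma quotient_carrier: "carrier quotient = coset ` carrier L"
  by (auto simp: quotient_superalgebra_def A_RCOSETS_def')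

lemma quotient_zero: "\<zero>\<^bsub>quotient\<^esub> = coset \<zero>"
  using submodule.subset[OF submodule_center] by (simp add: quotient_superalgebra_def)

lemma quotient_grade: "grade quotient d = coset ` grade L d"
  by (simp add: quotient_superalgebra_def)

lemma quotient_add:
  "x \<in> carrier L \<Longrightarrow> y \<in> carrier L \<Longrightarrow> coset x \<oplus>\<^bsub>quotient\<^esub> coset y = coset (x \<oplus> y)"
  by (simp add: quotient_superalgebra_def center.a_rcos_sum)

lemma quotient_smult:
  assumes c: "c \<in> carrier F" and x: "x \<in> carrier L"
  shows "c \<odot>\<^bsub>quotient\<^esub> coset x = coset (c \<odot> x)"
proof -
  have "coset (c \<odot> y) = coset (c \<odot> x)" if y: "y \<in> coset x" for y
  proof -
    obtain z where z: "z \<in> center L" "y = z \<oplus> x" using coset_memE[OF y] .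
    have "c \<odot> z \<in> center L" using submodule.smult_closed[OF submodule_center c z(1)] .
    then show ?thesis using coset_add_center z c x center_closed by (simp add: smult_r_distr)
  qed
  then show ?thesis
    using coset_nonempty[OF x] by (auto simp: quotient_superalgebra_def)
qed

text \<open>Central summands drop out on both sides. The bracket of two cosets is thus well defined
  with values in \<open>L\<close> itself, not merely modulo the center, which is what compatibility
  in an isoclinism refers to.\<close>

lemma bracket_coset:
  assumes "x' \<in> coset x" "y' \<in> coset y" "x \<in> carrier L" "y \<in> carrier L"
  shows "\<lbrakk>x', y'\<rbrakk> = \<lbrakk>x, y\<rbrakk>"
proof -
  obtain z w where zw: "z \<in> center L" "x' = z \<oplus> x" "w \<in> center L" "y' = w \<oplus> y"
    using coset_memE assms by metis
  then show ?thesis using assms center_closed center_left center_right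
    by (simp add: bracket_add_left bracket_add_right bracket_closed)
qed

lemma quotient_bracket:
  assumes x: "x \<in> carrier L" and y: "y \<in> carrier L"
  shows "\<lbrakk>coset x, coset y\<rbrakk>\<^bsub>quotient\<^esub> = coset \<lbrakk>x, y\<rbrakk>"
proof -
  have "(\<Union>x'\<in>coset x. \<Union>y'\<in>coset y. coset \<lbrakk>x', y'\<rbrakk>) = (\<Union>x'\<in>coset x. \<Union>y'\<in>coset y. coset \<lbrakk>x, y\<rbrakk>)"
    using bracket_coset[OF _ _ x y] by auto
  then show ?thesis
    using coset_nonempty[OF x] coset_nonempty[OF y] by (simp add: quotient_superalgebra_def)
qed

lemma vectorspace_quotient: "vectorspace F quotient"
  using module_image[OF module_axioms quotient_carrier quotient_zero quotient_add quotient_smult] field_axioms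
  by (simp add: vectorspace_def)

text \<open>Generation of \<open>L/Z(L)\<close> is an intersection over its subalgebras; this lets
  subalgebras of \<open>L\<close> take part in it.\<close>

lemma sub_superalgebra_quotient:
  assumes N: "sub_superalgebra F L N"
  shows "sub_superalgebra F quotient (coset ` N)"
proof -
  interpret N: submodule F N L using N by (simp add: sub_superalgebra_def subspace_def)
  have NL: "x \<in> N \<Longrightarrow> x \<in> carrier L" for x using N.subset by blast
  interpret Q: vectorspace F quotient by (rule vectorspace_quotient)
  have "submodule F (coset ` N) quotient"
  proof (rule submodule.intro)
    show "\<zero>\<^bsub>quotient\<^esub> \<in> coset ` N" using N.zero_closed quotient_zero by blast
  qed (use Q.module_axioms in \<open>auto simp: quotient_carrier NL quotient_add quotient_smult intro!: imageI\<close>)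
  moreover have "\<exists>x0\<in>coset ` N \<inter> grade quotient 0. \<exists>x1\<in>coset ` N \<inter> grade quotient 1.
      coset x = x0 \<oplus>\<^bsub>quotient\<^esub> x1" if "x \<in> N" for x
  proof -
    have "\<exists>x0\<in>N \<inter> grade L 0. \<exists>x1\<in>N \<inter> grade L 1. x = x0 \<oplus> x1"
      using N that by (simp add: sub_superalgebra_def)
    then obtain x0 x1 where "x0 \<in> N \<inter> grade L 0" "x1 \<in> N \<inter> grade L 1" "x = x0 \<oplus> x1"
      by blast
    then show ?thesis
      by (intro bexI[of _ "coset x0"] bexI[of _ "coset x1"]) (auto simp: quotient_grade quotient_add NL)
  qed
  moreover have "\<lbrakk>x, y\<rbrakk> \<in> N" if "x \<in> N" "y \<in> N" for x y
    using N that by (simp add: sub_superalgebra_def)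
  ultimately show ?thesis
    using vectorspace_quotient by (auto simp: sub_superalgebra_def subspace_def quotient_bracket NL)
qed

text \<open>The centralizer of \<open>z\<close> maps onto a subalgebra of the quotient that contains
  all generators, hence onto the whole quotient. Every \<open>x\<close> is then congruent modulo the
  center to some \<open>y\<close> commuting with \<open>z\<close>, and the bracket with
  \<open>z\<close> does not see the difference.\<close>

lemma central_of_commutes_generators:
  assumes z: "z \<in> grade L a"
    and T: "T \<subseteq> coset ` S" "S \<subseteq> carrier L"
    and gen: "\<Inter>{N. sub_superalgebra F quotient N \<and> T \<subseteq> N} = carrier quotient"
    and comm: "\<And>s. s \<in> S \<Longrightarrow> \<lbrakk>z, s\<rbrakk> = \<zero>"
  shows "z \<in> center L"
proof -
  let ?C = "{y \<in> carrier L. \<lbrakk>z, y\<rbrakk> = \<zero>}"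
  have "T \<subseteq> coset ` ?C" using T comm by blast
  then have sub: "coset ` carrier L \<subseteq> coset ` ?C"
    using sub_superalgebra_quotient[OF sub_superalgebra_centralizer[OF z]] gen quotient_carrier by blast
  have "\<lbrakk>z, x\<rbrakk> = \<zero>" if x: "x \<in> carrier L" for x
  proof -
    obtain y where y: "y \<in> ?C" "coset x = coset y" using sub x by blast
    then have "\<lbrakk>z, x\<rbrakk> = \<lbrakk>z, y\<rbrakk>"
      using bracket_coset[of z z x y] coset_eqD[OF y(2) x] center.a_rcos_self grade_closed[OF z] by blast
    then show ?thesis using y by simp
  qed
  then show ?thesis using grade_closed[OF z] by (intro centerI)
qed

end

section \<open>Isoclinism along an embedding\<close>

context lie_superalgebra
begin

abbreviation brackets :: "'a set" where
  "brackets \<equiv> {\<lbrakk>x, y\<rbrakk> | x y. x \<in> carrier L \<and> y \<in> carrier L}"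

lemma brackets_subset: "brackets \<subseteq> carrier L"
  by (auto simp: bracket_closed)

lemma submodule_derived: "submodule F (span brackets) L"
  by (rule span_is_submodule[OF brackets_subset])

lemma bracket_in_derived: "x \<in> carrier L \<Longrightarrow> y \<in> carrier L \<Longrightarrow> \<lbrakk>x, y\<rbrakk> \<in> span brackets"
  using in_own_span[OF brackets_subset] by blast

lemma derived_eq: "derived F L = L\<lparr>carrier := span brackets, grade := (\<lambda>d. span brackets \<inter> grade L d)\<rparr>"
  by (simp add: derived_def Let_def)

lemma module_derived: "module F (derived F L)"
  by (rule module_image[OF submodule_is_module[OF submodule_derived], of _ "\<lambda>x. x"])
    (auto simp: derived_eq)

end

lemma (in mod_hom) submodule_image:
  assumes "submodule R Q M"
  shows "submodule R (f ` Q) N"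
proof -
  interpret Q: submodule R Q M by fact
  have QM: "q \<in> Q \<Longrightarrow> q \<in> carrier M" for q using Q.subset by blast
  show ?thesis
  proof (rule submodule.intro)
    show "\<zero>\<^bsub>N\<^esub> \<in> f ` Q" using Q.zero_closed f0_is_0 by (metis imageI)
  qed (auto simp: QM N.module_axioms f_add[symmetric] f_smult[symmetric] simp del: f_add f_smult)
qed

lemma (in mod_hom) submodule_vimage:
  assumes "submodule R P N"
  shows "submodule R {x \<in> carrier M. f x \<in> P} M"
proof -
  interpret P: submodule R P N by fact
  show ?thesis
    by (rule submodule.intro) (auto simp: M.module_axioms)
qed

text \<open>Since the image of \<open>g\<close> and the center together fill \<open>L\<close>, every
  bracket of \<open>L\<close> is a bracket of elements of the image. Hence \<open>g\<close> matches
  the derived algebras and preserves and reflects centrality; both isomorphisms run from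
  \<open>L\<close> to \<open>K\<close>, against the direction of \<open>g\<close>.\<close>

lemma isoclinic_of_embedding:
  assumes L: "lie_superalgebra F L" and K: "lie_superalgebra F K" and g: "mod_hom F K L g"
    and bracket: "\<And>x y. x \<in> carrier K \<Longrightarrow> y \<in> carrier K \<Longrightarrow> g \<lbrakk>x, y\<rbrakk>\<^bsub>K\<^esub> = \<lbrakk>g x, g y\<rbrakk>\<^bsub>L\<^esub>"
    and grade: "\<And>x d. x \<in> carrier K \<Longrightarrow> g x \<in> grade L d \<longleftrightarrow> x \<in> grade K d"
    and inj: "inj_on g (carrier K)"
    and surj: "\<And>l. l \<in> carrier L \<Longrightarrow> \<exists>k\<in>carrier K. \<exists>z\<in>center L. l = z \<oplus>\<^bsub>L\<^esub> g k"
  shows "isoclinic F L K"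
proof -
  interpret L: lie_superalgebra F L by (rule L)
  interpret K: lie_superalgebra F K by (rule K)
  interpret g: mod_hom F K L g by (rule g)
  have gL [simp]: "x \<in> carrier K \<Longrightarrow> g x \<in> carrier L" for x by simp
  have g_eq: "g x = g y \<Longrightarrow> x = y" if "x \<in> carrier K" "y \<in> carrier K" for x y
    using inj that by (auto dest: inj_onD)

  have bracket_g: "\<exists>x\<in>carrier K. \<exists>y\<in>carrier K. \<lbrakk>l, m\<rbrakk>\<^bsub>L\<^esub> = \<lbrakk>g x, g y\<rbrakk>\<^bsub>L\<^esub> \<and> l \<in> L.coset (g x) \<and> m \<in> L.coset (g y)"
    if lm: "l \<in> carrier L" "m \<in> carrier L" for l m
  proof -
    obtain x z where x: "x \<in> carrier K" "z \<in> center L" "l = z \<oplus>\<^bsub>L\<^esub> g x" using surj[OF lm(1)] by blast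
    obtain y w where y: "y \<in> carrier K" "w \<in> center L" "m = w \<oplus>\<^bsub>L\<^esub> g y" using surj[OF lm(2)] by blast
    have "l \<in> L.coset (g x)" "m \<in> L.coset (g y)" using L.coset_memI x y by auto
    then show ?thesis using L.bracket_coset gL x(1) y(1) by blast
  qed

  have center_iff: "g k \<in> center L \<longleftrightarrow> k \<in> center K" if k: "k \<in> carrier K" for k
  proof
    assume gk: "g k \<in> center L"
    have "\<lbrakk>k, x\<rbrakk>\<^bsub>K\<^esub> = \<zero>\<^bsub>K\<^esub>" if "x \<in> carrier K" for x
      using g_eq[of "\<lbrakk>k, x\<rbrakk>\<^bsub>K\<^esub>" "\<zero>\<^bsub>K\<^esub>"] k that L.center_left[OF gk]
      by (simp add: bracket K.bracket_closed)
    then show "k \<in> center K" using k by (intro K.centerI)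
  next
    assume kz: "k \<in> center K"
    have "\<lbrakk>g k, l\<rbrakk>\<^bsub>L\<^esub> = \<zero>\<^bsub>L\<^esub>" if l: "l \<in> carrier L" for l
    proof -
      obtain x z where x: "x \<in> carrier K" "z \<in> center L" "l = z \<oplus>\<^bsub>L\<^esub> g x" using surj[OF l] by blast
      then have "\<lbrakk>g k, l\<rbrakk>\<^bsub>L\<^esub> = \<lbrakk>g k, g x\<rbrakk>\<^bsub>L\<^esub>"
        using k L.center_right by (simp add: L.bracket_add_right L.center_closed L.bracket_closed)
      also have "\<dots> = g \<zero>\<^bsub>K\<^esub>" using k x K.center_left[OF kz] by (simp add: bracket[symmetric])
      finally show ?thesis by simp
    qed
    then show "g k \<in> center L" using k by (intro L.centerI) auto
  qed
  have coset_iff: "g x \<in> L.coset (g y) \<longleftrightarrow> x \<in> K.coset y" if "x \<in> carrier K" "y \<in> carrier K" for x y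
  proof -
    have "g (x \<ominus>\<^bsub>K\<^esub> y) = g x \<ominus>\<^bsub>L\<^esub> g y" using that by simp
    then show ?thesis
      using that center_iff[of "x \<ominus>\<^bsub>K\<^esub> y"] L.center.a_rcos_module K.center.a_rcos_module
      by (simp add: a_minus_def)
  qed

  \<comment> \<open>Taking the preimage of a coset under \<open>g\<close> avoids choosing
    representatives.\<close>
  define \<alpha> where "\<alpha> X = {k \<in> carrier K. g k \<in> X}" for X
  have \<alpha>: "\<alpha> (L.coset (g k)) = K.coset k" if "k \<in> carrier K" for k
    using that coset_iff K.center.a_elemrcos_carrier unfolding \<alpha>_def by blast
  have cosets_L: "\<exists>k\<in>carrier K. L.coset l = L.coset (g k)" if l: "l \<in> carrier L" for l
    using surj[OF l] L.coset_add_center by (metis gL)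
  have carrier_L: "carrier L.quotient = (\<lambda>k. L.coset (g k)) ` carrier K"
    using cosets_L by (auto simp: L.quotient_carrier)
  have \<alpha>_iso: "\<alpha> \<in> lie_superalgebra_iso F L.quotient K.quotient"
  proof -
    have "\<alpha> \<in> module_hom F L.quotient K.quotient"
      unfolding module_hom_def
      by (auto simp: carrier_L \<alpha> K.quotient_carrier L.quotient_add K.quotient_add
          L.quotient_smult K.quotient_smult simp flip: g.f_add g.f_smult)
    then have "mod_hom F L.quotient K.quotient \<alpha>"
      using L.vectorspace_quotient K.vectorspace_quotient
      by (simp add: mod_hom_def mod_hom_axioms_def vectorspace_def)
    moreover have "\<alpha> \<lbrakk>X, Y\<rbrakk>\<^bsub>L.quotient\<^esub> = \<lbrakk>\<alpha> X, \<alpha> Y\<rbrakk>\<^bsub>K.quotient\<^esub>"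
      if "X \<in> carrier L.quotient" "Y \<in> carrier L.quotient" for X Y
      using that by (auto simp: carrier_L \<alpha> L.quotient_bracket K.quotient_bracket K.bracket_closed
          simp flip: bracket)
    moreover have "\<alpha> ` grade L.quotient d \<subseteq> grade K.quotient d" for d
    proof
      fix Y assume "Y \<in> \<alpha> ` grade L.quotient d"
      then obtain l where l: "l \<in> grade L d" "Y = \<alpha> (L.coset l)" by (auto simp: L.quotient_grade)
      obtain k where k: "k \<in> carrier K" "L.coset l = L.coset (g k)"
        using cosets_L L.grade_closed[OF l(1)] by blast
      \<comment> \<open>\<open>k\<close> may have components in both degrees. Only \<open>u\<close>
        is kept: its image under \<open>g\<close> still represents the coset of the homogeneous
        \<open>l\<close>.\<close>
      obtain u v where uv: "u \<in> grade K d" "v \<in> grade K (1 + d)" "k = u \<oplus>\<^bsub>K\<^esub> v"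
      proof -
        obtain k0 k1 where "k0 \<in> grade K 0" "k1 \<in> grade K 1" "k = k0 \<oplus>\<^bsub>K\<^esub> k1"
          using K.grade_decomp[OF k(1)] .
        then show thesis using that[of k0 k1] that[of k1 k0] K.M.a_comm K.grade_closed
          by (cases d) (simp_all add: one_add_one)
      qed
      note uvK = K.grade_closed[OF uv(1)] K.grade_closed[OF uv(2)]
      obtain z where z: "z \<in> center L" "l = z \<oplus>\<^bsub>L\<^esub> g k"
        using L.coset_eqD[OF k(2) L.grade_closed[OF l(1)]] by (rule L.coset_memE)
      have "L.coset l = L.coset (g u)"
        using L.coset_eq_homogeneous_part[OF l(1) _ _ z(1), of "g u" "g v"] z uv uvK by (simp add: grade)
      then show "Y \<in> grade K.quotient d"
        using l \<alpha>[OF uvK(1)] uv by (simp add: K.quotient_grade)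
    qed
    moreover have "inj_on \<alpha> (carrier L.quotient)"
    proof (rule inj_onI)
      fix X Y assume "X \<in> carrier L.quotient" "Y \<in> carrier L.quotient" and eq: "\<alpha> X = \<alpha> Y"
      then obtain x y where x: "x \<in> carrier K" "X = L.coset (g x)" and y: "y \<in> carrier K" "Y = L.coset (g y)"
        by (auto simp: carrier_L)
      have "x \<in> K.coset y" using eq \<alpha>[OF x(1)] \<alpha>[OF y(1)] K.center.a_rcos_self[OF x(1)] x(2) y(2) by simp
      then have "g x \<in> L.coset (g y)" using coset_iff x(1) y(1) by blast
      then show "X = Y" using x y L.center.a_repr_independence' by simp
    qed
    moreover have "\<alpha> ` carrier L.quotient = carrier K.quotient"
      by (auto simp: carrier_L \<alpha> K.quotient_carrier image_image)
    ultimately show ?thesis by (auto simp: lie_superalgebra_iso_def bij_betw_def)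
  qed

  define DL where "DL = L.span L.brackets"
  define DK where "DK = K.span K.brackets"
  have subDL: "submodule F DL L" and subDK: "submodule F DK K"
    unfolding DL_def DK_def by (rule L.submodule_derived K.submodule_derived)+
  have derL: "derived F L = L\<lparr>carrier := DL, grade := (\<lambda>d. DL \<inter> grade L d)\<rparr>"
    and derK: "derived F K = K\<lparr>carrier := DK, grade := (\<lambda>d. DK \<inter> grade K d)\<rparr>"
    unfolding DL_def DK_def by (rule L.derived_eq K.derived_eq)+
  have brL: "\<lbrakk>x, y\<rbrakk>\<^bsub>L\<^esub> \<in> DL" if "x \<in> carrier L" "y \<in> carrier L" for x y
    unfolding DL_def using that by (rule L.bracket_in_derived)
  have brK: "\<lbrakk>x, y\<rbrakk>\<^bsub>K\<^esub> \<in> DK" if "x \<in> carrier K" "y \<in> carrier K" for x y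
    unfolding DK_def using that by (rule K.bracket_in_derived)
  have DK: "x \<in> DK \<Longrightarrow> x \<in> carrier K" for x
    using submodule.subset[OF subDK] by blast
  \<comment> \<open>Images and preimages of submodules under \<open>g\<close> are submodules, so
    both inclusions need checking on brackets only.\<close>
  have gDK: "g ` DK = DL"
  proof
    have "DK \<subseteq> {x \<in> carrier K. g x \<in> DL}"
      unfolding DK_def
      by (rule K.span_is_subset[OF _ g.submodule_vimage[OF subDL]])
        (auto simp: bracket K.bracket_closed brL)
    then show "g ` DK \<subseteq> DL" by blast
    have "\<lbrakk>l, m\<rbrakk>\<^bsub>L\<^esub> \<in> g ` DK" if lm: "l \<in> carrier L" "m \<in> carrier L" for l m
    proof -
      obtain x y where xy: "x \<in> carrier K" "y \<in> carrier K" "\<lbrakk>l, m\<rbrakk>\<^bsub>L\<^esub> = \<lbrakk>g x, g y\<rbrakk>\<^bsub>L\<^esub>"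
        using bracket_g[OF lm] by blast
      then have "\<lbrakk>l, m\<rbrakk>\<^bsub>L\<^esub> = g \<lbrakk>x, y\<rbrakk>\<^bsub>K\<^esub>" by (simp add: bracket)
      then show ?thesis using brK[OF xy(1,2)] by (rule image_eqI)
    qed
    then have "L.brackets \<subseteq> g ` DK" by blast
    then show "DL \<subseteq> g ` DK"
      unfolding DL_def by (rule L.span_is_subset[OF _ g.submodule_image[OF subDK]])
  qed
  define \<beta> where "\<beta> = inv_into (carrier K) g"
  have \<beta>g: "\<beta> (g x) = x" if "x \<in> carrier K" for x
    using inj that by (simp add: \<beta>_def)
  have \<beta>_add: "\<beta> (g x \<oplus>\<^bsub>L\<^esub> g y) = x \<oplus>\<^bsub>K\<^esub> y" if "x \<in> DK" "y \<in> DK" for x y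
    using \<beta>g[of "x \<oplus>\<^bsub>K\<^esub> y"] that DK by simp
  have \<beta>_smult: "\<beta> (c \<odot>\<^bsub>L\<^esub> g x) = c \<odot>\<^bsub>K\<^esub> x" if "c \<in> carrier F" "x \<in> DK" for c x
    using \<beta>g[of "c \<odot>\<^bsub>K\<^esub> x"] that DK by simp
  have \<beta>_bracket: "\<beta> \<lbrakk>g x, g y\<rbrakk>\<^bsub>L\<^esub> = \<lbrakk>x, y\<rbrakk>\<^bsub>K\<^esub>" if "x \<in> DK" "y \<in> DK" for x y
    using \<beta>g[of "\<lbrakk>x, y\<rbrakk>\<^bsub>K\<^esub>"] that DK by (simp add: bracket K.bracket_closed)
  have \<beta>_iso: "\<beta> \<in> lie_superalgebra_iso F (derived F L) (derived F K)"
  proof -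
    have "\<beta> \<in> module_hom F (derived F L) (derived F K)"
      unfolding module_hom_def derL derK
      by (auto simp: gDK[symmetric] DK \<beta>g \<beta>_add \<beta>_smult)
    then have "mod_hom F (derived F L) (derived F K) \<beta>"
      using L.module_derived K.module_derived by (simp add: mod_hom_def mod_hom_axioms_def)
    moreover have "\<beta> \<lbrakk>X, Y\<rbrakk>\<^bsub>derived F L\<^esub> = \<lbrakk>\<beta> X, \<beta> Y\<rbrakk>\<^bsub>derived F K\<^esub>"
      if "X \<in> carrier (derived F L)" "Y \<in> carrier (derived F L)" for X Y
      using that unfolding derL derK by (auto simp: gDK[symmetric] DK \<beta>g \<beta>_bracket)
    moreover have "\<beta> ` grade (derived F L) d \<subseteq> grade (derived F K) d" for d
      unfolding derL derK by (auto simp: gDK[symmetric] DK \<beta>g grade)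
    moreover have "bij_betw \<beta> (carrier (derived F L)) (carrier (derived F K))"
      unfolding derL derK by (rule bij_betwI[of _ _ _ g]) (auto simp: gDK[symmetric] DK \<beta>g)
    ultimately show ?thesis by (simp add: lie_superalgebra_iso_def)
  qed
  have "\<beta> \<lbrakk>l, m\<rbrakk>\<^bsub>L\<^esub> = \<lbrakk>k, r\<rbrakk>\<^bsub>K\<^esub>"
    if lm: "l \<in> carrier L" "m \<in> carrier L" and kr: "k \<in> carrier K" "r \<in> carrier K"
      and k: "K.coset k = \<alpha> (L.coset l)" and r: "K.coset r = \<alpha> (L.coset m)" for l m k r
  proof -
    \<comment> \<open>By the choice of \<open>\<alpha>\<close>, the coset of \<open>k\<close> being
      the preimage of the coset of \<open>l\<close> says just that \<open>g k\<close> is congruent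
      to \<open>l\<close> modulo the center.\<close>
    have "g k \<in> L.coset l" "g r \<in> L.coset m"
      using k r kr K.center.a_rcos_self unfolding \<alpha>_def by blast+
    then have "\<lbrakk>l, m\<rbrakk>\<^bsub>L\<^esub> = g \<lbrakk>k, r\<rbrakk>\<^bsub>K\<^esub>"
      using L.bracket_coset lm kr by (simp add: bracket)
    then show ?thesis using \<beta>g kr by (simp add: K.bracket_closed)
  qed
  then show ?thesis
    unfolding isoclinic_def using \<alpha>_iso \<beta>_iso by blast
qed

section \<open>Carrying a graded subalgebra to another carrier type\<close>

text \<open>As \<open>g\<close> is injective, each identity in \<open>K\<close> can be checked after
  applying \<open>g\<close>, where it becomes an axiom of \<open>L\<close>. That the image is a
  graded subspace supplies what is not an identity: additive inverses and homogeneous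
  components.\<close>

lemma lie_superalgebra_pullback:
  assumes L: "lie_superalgebra F L"
    and inj: "inj_on g (carrier K)"
    and sub: "sub_superalgebra F L (g ` carrier K)"
    and zero: "\<zero>\<^bsub>K\<^esub> \<in> carrier K" "g \<zero>\<^bsub>K\<^esub> = \<zero>\<^bsub>L\<^esub>"
    and add: "\<And>x y. x \<in> carrier K \<Longrightarrow> y \<in> carrier K \<Longrightarrow> x \<oplus>\<^bsub>K\<^esub> y \<in> carrier K"
      "\<And>x y. x \<in> carrier K \<Longrightarrow> y \<in> carrier K \<Longrightarrow> g (x \<oplus>\<^bsub>K\<^esub> y) = g x \<oplus>\<^bsub>L\<^esub> g y"
    and smult: "\<And>c x. c \<in> carrier F \<Longrightarrow> x \<in> carrier K \<Longrightarrow> c \<odot>\<^bsub>K\<^esub> x \<in> carrier K"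
      "\<And>c x. c \<in> carrier F \<Longrightarrow> x \<in> carrier K \<Longrightarrow> g (c \<odot>\<^bsub>K\<^esub> x) = c \<odot>\<^bsub>L\<^esub> g x"
    and bracket: "\<And>x y. x \<in> carrier K \<Longrightarrow> y \<in> carrier K \<Longrightarrow> \<lbrakk>x, y\<rbrakk>\<^bsub>K\<^esub> \<in> carrier K"
      "\<And>x y. x \<in> carrier K \<Longrightarrow> y \<in> carrier K \<Longrightarrow> g \<lbrakk>x, y\<rbrakk>\<^bsub>K\<^esub> = \<lbrakk>g x, g y\<rbrakk>\<^bsub>L\<^esub>"
    and grade: "\<And>d. grade K d = {x \<in> carrier K. g x \<in> grade L d}"
  shows "lie_superalgebra F K" and "mod_hom F K L g"
proof -
  interpret L: lie_superalgebra F L by (rule L)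
  have subm: "submodule F (g ` carrier K) L" using sub by (simp add: sub_superalgebra_def subspace_def)
  have gL [simp]: "g x \<in> carrier L" if "x \<in> carrier K" for x
    using submodule.subset[OF subm] that by blast
  have eqI: "x = y" if "x \<in> carrier K" "y \<in> carrier K" "g x = g y" for x y
    using inj that by (auto dest: inj_onD)
  have neg: "\<exists>w\<in>carrier K. v \<oplus>\<^bsub>K\<^esub> w = \<zero>\<^bsub>K\<^esub>" if v: "v \<in> carrier K" for v
  proof -
    have "\<zero>\<^bsub>L\<^esub> \<ominus>\<^bsub>L\<^esub> g v \<in> g ` carrier K"
      using L.submodule_minus_closed[OF subm submodule.zero_closed[OF subm]] v by blast
    then obtain w where w: "w \<in> carrier K" "g w = \<ominus>\<^bsub>L\<^esub> g v" using v by (auto simp: a_minus_def)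
    then have "v \<oplus>\<^bsub>K\<^esub> w = \<zero>\<^bsub>K\<^esub>" using v zero add by (intro eqI) (auto simp: L.M.r_neg)
    then show ?thesis using w by blast
  qed
  have module: "module F K"
    by (rule module_criteria[OF L.R.cring_axioms])
      (auto simp: neg zero add smult L.M.a_ac L.smult_l_distr L.smult_r_distr L.smult_assoc1 intro!: eqI)
  show g: "mod_hom F K L g"
    using module L.module_axioms add smult
    by (auto simp: mod_hom_def mod_hom_axioms_def module_hom_def)
  interpret g: mod_hom F K L g by (rule g)
  interpret K: vectorspace F K using module L.field_axioms by (simp add: vectorspace_def)
  have gradeK: "x \<in> grade K d \<Longrightarrow> x \<in> carrier K" "x \<in> grade K d \<Longrightarrow> g x \<in> grade L d" for x d
    by (simp_all add: grade)
  show "lie_superalgebra F K"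
  proof (intro lie_superalgebra.intro lie_superalgebra_axioms.intro K.vectorspace_axioms)
    fix d
    show "subspace F (grade K d) K"
      using g.submodule_vimage[OF L.submodule_grade[of d]] K.vectorspace_axioms
      by (simp add: grade subspace_def)
  next
    fix x assume x: "x \<in> carrier K"
    have "\<exists>x0\<in>g ` carrier K \<inter> grade L 0. \<exists>x1\<in>g ` carrier K \<inter> grade L 1. g x = x0 \<oplus>\<^bsub>L\<^esub> x1"
      using sub x by (simp add: sub_superalgebra_def)
    then obtain x0 x1 where "x0 \<in> grade K 0" "x1 \<in> grade K 1" "g x = g x0 \<oplus>\<^bsub>L\<^esub> g x1"
      by (auto simp: grade)
    moreover from this have "x = x0 \<oplus>\<^bsub>K\<^esub> x1" using x gradeK by (intro eqI) auto
    ultimately show "\<exists>x0\<in>grade K 0. \<exists>x1\<in>grade K 1. x = x0 \<oplus>\<^bsub>K\<^esub> x1" by blast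
  next
    have "x = \<zero>\<^bsub>K\<^esub>" if "x \<in> grade K 0 \<inter> grade K 1" for x
      using that L.grade_Int zero by (intro eqI) (auto simp: grade)
    moreover have "\<zero>\<^bsub>K\<^esub> \<in> grade K 0 \<inter> grade K 1"
      using zero submodule.zero_closed[OF L.submodule_grade] by (simp add: grade)
    ultimately show "grade K 0 \<inter> grade K 1 = {\<zero>\<^bsub>K\<^esub>}" by blast
  next
    fix x y and a b :: bit assume xy: "x \<in> grade K a" "y \<in> grade K b"
    then show "\<lbrakk>x, y\<rbrakk>\<^bsub>K\<^esub> \<in> grade K (a + b)"
      using L.bracket_grade[of "g x" a "g y" b] by (simp add: grade bracket)
    show "\<lbrakk>x, y\<rbrakk>\<^bsub>K\<^esub> = \<ominus>\<^bsub>K\<^esub> (ksign F a b \<odot>\<^bsub>K\<^esub> \<lbrakk>y, x\<rbrakk>\<^bsub>K\<^esub>)"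
      using xy L.bracket_skew[of "g x" a "g y" b] gradeK by (intro eqI) (auto simp: bracket)
  next
    fix x y z a b c assume xyz: "x \<in> grade K a" "y \<in> grade K b" "z \<in> grade K c"
    then have carr: "x \<in> carrier K" "y \<in> carrier K" "z \<in> carrier K" using gradeK by auto
    show "ksign F a c \<odot>\<^bsub>K\<^esub> \<lbrakk>x, \<lbrakk>y, z\<rbrakk>\<^bsub>K\<^esub>\<rbrakk>\<^bsub>K\<^esub> \<oplus>\<^bsub>K\<^esub> ksign F b a \<odot>\<^bsub>K\<^esub> \<lbrakk>y, \<lbrakk>z, x\<rbrakk>\<^bsub>K\<^esub>\<rbrakk>\<^bsub>K\<^esub> \<oplus>\<^bsub>K\<^esub>
        ksign F c b \<odot>\<^bsub>K\<^esub> \<lbrakk>z, \<lbrakk>x, y\<rbrakk>\<^bsub>K\<^esub>\<rbrakk>\<^bsub>K\<^esub> = \<zero>\<^bsub>K\<^esub>"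
      using L.jacobi[of "g x" a "g y" b "g z" c] gradeK(2) xyz carr by (intro eqI) (auto simp: bracket)
  qed (auto intro!: eqI simp: bracket L.bracket_add_left L.bracket_add_right
      L.bracket_smult_left L.bracket_smult_right)
qed

text \<open>Any injection \<open>f\<close> on \<open>C\<close> will do: no linear structure on the target type is used.\<close>
definition transport ::
  "('f, 'a, 'x) lie_superalgebra_scheme \<Rightarrow> 'a set \<Rightarrow> ('a \<Rightarrow> 'b) \<Rightarrow> ('f, 'b) lie_superalgebra" where
  "transport L C f = (let g = inv_into C f in
     \<lparr>carrier = f ` C, mult = undefined, one = undefined, zero = f \<zero>\<^bsub>L\<^esub>,
      add = (\<lambda>x y. f (g x \<oplus>\<^bsub>L\<^esub> g y)), smult = (\<lambda>c x. f (c \<odot>\<^bsub>L\<^esub> g x)),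
      bracket = (\<lambda>x y. f \<lbrakk>g x, g y\<rbrakk>\<^bsub>L\<^esub>), grade = (\<lambda>d. f ` (C \<inter> grade L d))\<rparr>)"

text \<open>The embedding into \<open>L\<close> is the inverse of \<open>f\<close> on
  \<open>C\<close>. Its image is \<open>C\<close>, and the transported operations are defined so
  that it is a homomorphism.\<close>

lemma isoclinic_transport:
  fixes f :: "'a \<Rightarrow> 'b"
  assumes L: "lie_superalgebra F L" and C: "sub_superalgebra F L C" and f: "inj_on f C"
    and surj: "\<And>l. l \<in> carrier L \<Longrightarrow> \<exists>k\<in>C. \<exists>z\<in>center L. l = z \<oplus>\<^bsub>L\<^esub> k"
  shows "lie_superalgebra F (transport L C f)" and "isoclinic F L (transport L C f)"
    and "vectorspace.fin_dim F (L\<lparr>carrier := C\<rparr>) \<Longrightarrow> vectorspace.fin_dim F (transport L C f)"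
proof -
  interpret L: lie_superalgebra F L by (rule L)
  let ?K = "transport L C f" and ?g = "inv_into C f"
  have subs: "subspace F C L" using C by (simp add: sub_superalgebra_def)
  interpret C: submodule F C L using subs by (simp add: subspace_def)
  have [simp]: "?g (f x) = x" if "x \<in> C" for x using f that by simp
  have br: "\<lbrakk>x, y\<rbrakk>\<^bsub>L\<^esub> \<in> C" if "x \<in> C" "y \<in> C" for x y using C that by (simp add: sub_superalgebra_def)
  have carrier: "carrier ?K = f ` C" by (simp add: transport_def Let_def)
  have img: "?g ` carrier ?K = C" by (auto simp: carrier image_image)
  have inj: "inj_on ?g (carrier ?K)" by (auto simp: carrier intro: inj_onI)
  have grade: "grade ?K d = {x \<in> carrier ?K. ?g x \<in> grade L d}" for d
    by (auto simp: transport_def Let_def)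
  have subK: "sub_superalgebra F L (?g ` carrier ?K)" using C img by simp
  note pb = lie_superalgebra_pullback[of F L ?g ?K, OF L inj subK _ _ _ _ _ _ _ _ grade]
  have K: "lie_superalgebra F ?K" and g: "mod_hom F ?K L ?g"
    by (rule pb; auto simp: transport_def Let_def br)+
  show "lie_superalgebra F ?K" by (rule K)
  show "isoclinic F L ?K"
  proof (rule isoclinic_of_embedding[OF L K g _ _ inj])
    show "\<exists>k\<in>carrier ?K. \<exists>z\<in>center L. l = z \<oplus>\<^bsub>L\<^esub> ?g k" if "l \<in> carrier L" for l
      using surj[OF that] by (auto simp: carrier)
  qed (auto simp: grade, auto simp: transport_def Let_def br)
  assume fd: "vectorspace.fin_dim F (L\<lparr>carrier := C\<rparr>)"
  interpret K: lie_superalgebra F ?K by (rule K)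
  interpret V: vectorspace F "L\<lparr>carrier := C\<rparr>" by (rule L.subspace_is_vs[OF subs])
  interpret f: linear_map F "L\<lparr>carrier := C\<rparr>" ?K f
    by unfold_locales (auto simp: module_hom_def transport_def Let_def)
  show "vectorspace.fin_dim F ?K"
    by (rule f.surj_fin_dim[OF fd]) (simp add: carrier)
qed

section \<open>Finite spanning sets and coordinates\<close>

lemma (in mod_hom) image_span:
  assumes "A \<subseteq> carrier M" "x \<in> M.span A"
  shows "f x \<in> N.span (f ` A)"
proof -
  have "f ` A \<subseteq> carrier N" using assms(1) by auto
  then have "M.span A \<subseteq> {x \<in> carrier M. f x \<in> N.span (f ` A)}"
    using N.in_own_span assms(1) by (intro M.span_is_subset submodule_vimage N.span_is_submodule) auto
  then show ?thesis using assms(2) by blast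
qed

text \<open>The identity is a linear map from \<open>W\<close> to \<open>V\<close>, so a spanning
  set found in \<open>W\<close> also spans in \<open>V\<close>. Fixing only carrier and module
  operations of \<open>W\<close> admits the graded pieces of \<open>derived\<close>.\<close>

lemma (in vectorspace) fin_dim_generators:
  assumes sub: "submodule K G V" and carrier: "carrier W = G"
    and zero: "zero W = zero V" and add: "add W = add V" and smult: "smult W = smult V"
    and fin_dim: "vectorspace.fin_dim K W"
  shows "\<exists>A. finite A \<and> A \<subseteq> G \<and> G \<subseteq> span A"
proof -
  have W: "module K W"
    by (rule module_image[OF submodule_is_module[OF sub], of _ "\<lambda>x. x"])
      (simp_all add: carrier zero add smult)
  have GV: "G \<subseteq> carrier V" by (rule submodule.subset[OF sub])
  interpret W: vectorspace K W using W field_axioms by (simp add: vectorspace_def)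
  interpret i: mod_hom K W V "\<lambda>x. x"
    by (intro mod_hom.intro mod_hom_axioms.intro W module_axioms)
      (use GV in \<open>auto simp: module_hom_def carrier add smult\<close>)
  obtain A where A: "finite A" "A \<subseteq> carrier W" "W.module.span A = carrier W"
    using fin_dim unfolding W.fin_dim_def by blast
  then have "G \<subseteq> span A" using i.image_span[OF A(2)] carrier by auto
  then show ?thesis using A carrier by blast
qed

text \<open>A chosen coefficient vector determines its element, which gives injectivity even when
  \<open>H\<close> is dependent and the choice is not linear. Numbering \<open>H\<close> turns
  coefficients into functions on the naturals.\<close>

lemma (in module) inj_on_finite_span:
  assumes "finite H" "H \<subseteq> carrier M"
  shows "\<exists>f :: 'c \<Rightarrow> nat \<Rightarrow> 'a. inj_on f (span H)"
proof -
  obtain h :: "'c \<Rightarrow> nat" where h: "inj_on h H"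
    using finite_imp_inj_to_nat_seg[OF assms(1)] by blast
  have "\<forall>v\<in>span H. \<exists>a. a \<in> H \<rightarrow> carrier R \<and> lincomb a H = v"
    using finite_in_span[OF assms] by blast
  then obtain a where a: "\<And>v. v \<in> span H \<Longrightarrow> a v \<in> H \<rightarrow> carrier R \<and> lincomb (a v) H = v"
    by metis
  \<comment> \<open>At indices that number no element of \<open>H\<close> the value is arbitrary;
    only indices \<open>h u\<close> with \<open>u\<close> in \<open>H\<close> enter the
    comparison.\<close>
  have "inj_on (\<lambda>v i. a v (inv_into H h i)) (span H)"
  proof (rule inj_onI)
    fix v w assume v: "v \<in> span H" and w: "w \<in> span H"
      and eq: "(\<lambda>i. a v (inv_into H h i)) = (\<lambda>i. a w (inv_into H h i))"
    have "a v u = a w u" if "u \<in> H" for u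
      using fun_cong[OF eq, of "h u"] h that by simp
    then have "lincomb (a v) H = lincomb (a w) H"
      using a[OF w] assms by (intro lincomb_cong) auto
    then show "v = w" using a[OF v] a[OF w] by simp
  qed
  then show ?thesis by blast
qed

section \<open>A finite-dimensional subalgebra complementing the center\<close>

context lie_superalgebra
begin

text \<open>The elements whose two components can be found in \<open>span H\<close> form a
  submodule, and it contains \<open>H\<close> because a homogeneous element has zero as its other
  component.\<close>

lemma span_homogeneous_decomp:
  assumes H: "H \<subseteq> grade L 0 \<union> grade L 1" and x: "x \<in> span H"
  shows "\<exists>x0\<in>span H \<inter> grade L 0. \<exists>x1\<in>span H \<inter> grade L 1. x = x0 \<oplus> x1"
proof -
  have HL: "H \<subseteq> carrier L" using H grade_closed by blast
  interpret S: submodule F "span H" L by (rule span_is_submodule[OF HL])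
  interpret G0: submodule F "grade L 0" L by (rule submodule_grade)
  interpret G1: submodule F "grade L 1" L by (rule submodule_grade)
  let ?P = "{x. \<exists>x0\<in>span H \<inter> grade L 0. \<exists>x1\<in>span H \<inter> grade L 1. x = x0 \<oplus> x1}"
  have "submodule F ?P L"
  proof (rule submodule.intro)
    show "module F L" by (rule module_axioms)
    show "?P \<subseteq> carrier L" using grade_closed by auto
    show "\<zero> \<in> ?P" by (auto intro!: bexI[of _ \<zero>])
  next
    fix v w assume "v \<in> ?P" "w \<in> ?P"
    then obtain v0 v1 w0 w1 where *: "v0 \<in> span H \<inter> grade L 0" "v1 \<in> span H \<inter> grade L 1" "v = v0 \<oplus> v1"
      "w0 \<in> span H \<inter> grade L 0" "w1 \<in> span H \<inter> grade L 1" "w = w0 \<oplus> w1" by blast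
    then have "v0 \<in> carrier L" "v1 \<in> carrier L" "w0 \<in> carrier L" "w1 \<in> carrier L"
      using grade_closed by blast+
    then have "v \<oplus> w = (v0 \<oplus> w0) \<oplus> (v1 \<oplus> w1)" using *(3,6) by (simp add: M.a_ac)
    then show "v \<oplus> w \<in> ?P" using * by blast
  next
    fix c v assume c: "c \<in> carrier F" and "v \<in> ?P"
    then obtain v0 v1 where *: "v0 \<in> span H \<inter> grade L 0" "v1 \<in> span H \<inter> grade L 1" "v = v0 \<oplus> v1" by blast
    then have "v0 \<in> carrier L" "v1 \<in> carrier L" using grade_closed by blast+
    then have "c \<odot> v = c \<odot> v0 \<oplus> c \<odot> v1" using *(3) c by (simp add: smult_r_distr)
    then show "c \<odot> v \<in> ?P" using * c by blast
  qed
  moreover have "H \<subseteq> ?P"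
  proof
    fix h assume h: "h \<in> H"
    then have hs: "h \<in> span H" and hL: "h \<in> carrier L" using in_own_span[OF HL] HL by blast+
    have e: "h = h \<oplus> \<zero>" "h = \<zero> \<oplus> h" using hL by simp_all
    show "h \<in> ?P"
    proof (cases "h \<in> grade L 0")
      case True
      then show ?thesis using e(1) hs S.zero_closed G1.zero_closed by blast
    next
      case False
      then have "h \<in> grade L 1" using h H by blast
      then show ?thesis using e(2) hs S.zero_closed G0.zero_closed by blast
    qed
  qed
  ultimately show ?thesis using span_is_subset x by blast
qed

text \<open>Each degree of \<open>L^2\<close> is finitely spanned, and a bracket of homogeneous
  elements falls into a single degree. Restricting the claim to such brackets avoids splitting
  \<open>L^2\<close> into its graded parts.\<close>

lemma finite_derived_generators:
  assumes "has_superdim F (derived F L) r s"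
  shows "\<exists>A. finite A \<and> A \<subseteq> grade L 0 \<union> grade L 1 \<and>
    (\<forall>a b. \<forall>x\<in>grade L a. \<forall>y\<in>grade L b. \<lbrakk>x, y\<rbrakk> \<in> span A)"
proof -
  have "\<exists>A. finite A \<and> A \<subseteq> grade L d \<and> span brackets \<inter> grade L d \<subseteq> span A"
    (is "\<exists>A. ?P d A") for d
  proof -
    let ?G = "span brackets \<inter> grade L d"
    let ?W = "derived F L\<lparr>carrier := grade (derived F L) d\<rparr>"
    have sub: "submodule F ?G L"
      by (rule submodule_Int[OF submodule_derived submodule_grade])
    have carrier: "carrier ?W = ?G" by (simp add: derived_eq)
    have "vectorspace.fin_dim F ?W" using assms by (cases "d = 0") (auto simp: has_superdim_def)
    then have "\<exists>A. finite A \<and> A \<subseteq> ?G \<and> ?G \<subseteq> span A"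
      by (intro fin_dim_generators[OF sub carrier]) (simp_all add: derived_eq)
    then show ?thesis by auto
  qed
  then have "\<forall>d. \<exists>A. ?P d A" ..
  then obtain A where AP: "\<forall>d. ?P d (A d)" unfolding choice_iff ..
  then have A: "finite (A d)" "A d \<subseteq> grade L d" "span brackets \<inter> grade L d \<subseteq> span (A d)" for d
    by simp_all
  have "\<lbrakk>x, y\<rbrakk> \<in> span (A 0 \<union> A 1)" if "x \<in> grade L a" "y \<in> grade L b" for a b x y
  proof -
    have "\<lbrakk>x, y\<rbrakk> \<in> span (A (a + b))"
      using bracket_grade[OF that] bracket_in_derived grade_closed that A(3) by blast
    moreover have "A (a + b) \<subseteq> A 0 \<union> A 1" by (cases "a + b = 0") auto
    ultimately show ?thesis using span_is_monotone by blast
  qed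
  then show ?thesis using A(1,2) by (intro exI[of _ "A 0 \<union> A 1"]) blast
qed

lemma linear_map_bracket_right:
  assumes "s \<in> carrier L"
  shows "linear_map F L L (\<lambda>q. \<lbrakk>q, s\<rbrakk>)"
  using assms by unfold_locales (auto simp: module_hom_def bracket_closed bracket_add_left bracket_smult_left)

text \<open>Induction on \<open>S\<close>: on the elements \<open>Q\<close> of degree
  \<open>a\<close> that already commute with \<open>S\<close>, bracketing with the next
  \<open>s\<close> takes values in \<open>span A\<close>, so finitely many \<open>Y\<close> inside
  \<open>Q\<close> account for all of them.\<close>

lemma finite_codim_centralizer:
  assumes A: "finite A" "A \<subseteq> carrier L"
    and br: "\<forall>a b. \<forall>x\<in>grade L a. \<forall>y\<in>grade L b. \<lbrakk>x, y\<rbrakk> \<in> span A"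
    and S: "finite S" "S \<subseteq> grade L 0 \<union> grade L 1"
  shows "\<exists>X. finite X \<and> X \<subseteq> grade L a \<and>
    (\<forall>q\<in>grade L a. \<exists>x\<in>span X. \<forall>s\<in>S. \<lbrakk>q \<ominus> x, s\<rbrakk> = \<zero>)"
  using S
proof (induction S rule: finite_induct)
  case empty
  then show ?case by (intro exI[of _ "{}"]) (auto simp: span_empty)
next
  case (insert s S)
  interpret G: submodule F "grade L a" L by (rule submodule_grade)
  have SL: "t \<in> carrier L" if "t \<in> insert s S" for t using that insert.prems grade_closed by blast
  obtain X where X: "finite X" "X \<subseteq> grade L a"
    and Xq: "\<forall>q\<in>grade L a. \<exists>x\<in>span X. \<forall>t\<in>S. \<lbrakk>q \<ominus> x, t\<rbrakk> = \<zero>"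
    using insert.IH[OF order.trans[OF subset_insertI insert.prems]] by (elim exE conjE)
  define Q where "Q = {q \<in> grade L a. \<forall>t\<in>S. \<lbrakk>q, t\<rbrakk> = \<zero>}"
  have Q: "submodule F Q L"
    unfolding Q_def using G.subset
    by (intro submodule.intro module_axioms)
      (auto simp: bracket_add_left bracket_smult_left grade_closed SL)
  interpret T: linear_map F L L "\<lambda>q. \<lbrakk>q, s\<rbrakk>" using SL by (intro linear_map_bracket_right) simp
  obtain b where s: "s \<in> grade L b" using insert.prems by blast
  have "(\<lambda>q. \<lbrakk>q, s\<rbrakk>) ` Q \<subseteq> span A" using br s by (auto simp: Q_def)
  then obtain Y where Y: "finite Y" "Y \<subseteq> Q" "\<And>q. q \<in> Q \<Longrightarrow> \<exists>y\<in>span Y. \<lbrakk>q, s\<rbrakk> = \<lbrakk>y, s\<rbrakk>"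
    using T.finite_preimage_generators[OF A Q] by blast
  have YG: "X \<union> Y \<subseteq> grade L a" using X Y by (auto simp: Q_def)
  have XYL: "X \<union> Y \<subseteq> carrier L" using YG grade_closed by blast
  interpret XY: submodule F "span (X \<union> Y)" L by (rule span_is_submodule[OF XYL])
  have "\<exists>x\<in>span (X \<union> Y). \<forall>t\<in>insert s S. \<lbrakk>q \<ominus> x, t\<rbrakk> = \<zero>" if q: "q \<in> grade L a" for q
  proof -
    obtain x where x: "x \<in> span X" "\<And>t. t \<in> S \<Longrightarrow> \<lbrakk>q \<ominus> x, t\<rbrakk> = \<zero>" using bspec[OF Xq q] by blast
    have xG: "x \<in> grade L a" using span_is_subset[OF X(2) submodule_grade] x by blast
    have qx: "q \<ominus> x \<in> Q" using x q xG submodule_minus_closed[OF submodule_grade] by (simp add: Q_def)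
    \<comment> \<open>\<open>x\<close> settles the generators in \<open>S\<close>; the further
      correction \<open>y\<close> settles \<open>s\<close> and, lying in \<open>Q\<close>, leaves
      the brackets with \<open>S\<close> zero.\<close>
    obtain y where y: "y \<in> span Y" "\<lbrakk>q \<ominus> x, s\<rbrakk> = \<lbrakk>y, s\<rbrakk>" using Y(3)[OF qx] by blast
    have yQ: "y \<in> Q" using span_is_subset[OF Y(2) Q] y by blast
    note carr = grade_closed[OF q] grade_closed[OF xG]
    have yL: "y \<in> carrier L" using yQ grade_closed by (auto simp: Q_def)
    have eq: "q \<ominus> (x \<oplus> y) = (q \<ominus> x) \<ominus> y"
      using carr yL by (simp add: a_minus_def M.minus_add M.a_ac)
    have diff: "\<lbrakk>q \<ominus> (x \<oplus> y), t\<rbrakk> = \<lbrakk>q \<ominus> x, t\<rbrakk> \<ominus> \<lbrakk>y, t\<rbrakk>" if "t \<in> carrier L" for t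
    proof -
      interpret t: linear_map F L L "\<lambda>q. \<lbrakk>q, t\<rbrakk>" by (rule linear_map_bracket_right[OF that])
      show ?thesis unfolding eq using carr yL by (intro t.T_minus) auto
    qed
    have "\<lbrakk>q \<ominus> (x \<oplus> y), t\<rbrakk> = \<zero>" if t: "t \<in> insert s S" for t
    proof (cases "t = s")
      case True
      then show ?thesis using diff[OF SL[OF t]] y yL SL[OF t] by (simp add: a_minus_def M.r_neg bracket_closed)
    next
      case False
      then have "t \<in> S" using t by simp
      then show ?thesis using diff[OF SL[OF t]] x yQ by (simp add: Q_def a_minus_def)
    qed
    moreover have "x \<oplus> y \<in> span (X \<union> Y)"
      using x y span_is_monotone[of X "X \<union> Y"] span_is_monotone[of Y "X \<union> Y"] by blast
    ultimately show ?thesis by blast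
  qed
  then show ?case using X Y YG by (intro exI[of _ "X \<union> Y"]) blast
qed

lemma finite_superalgebra_mod_center:
  assumes fg: "finitely_generated F quotient" and dim: "has_superdim F (derived F L) r s"
  shows "\<exists>H. finite H \<and> H \<subseteq> carrier L \<and> sub_superalgebra F L (span H)
    \<and> (\<forall>l\<in>carrier L. \<exists>k\<in>span H. \<exists>z\<in>center L. l = z \<oplus> k)"
proof -
  obtain A where A: "finite A" "A \<subseteq> grade L 0 \<union> grade L 1"
    and brA: "\<forall>a b. \<forall>x\<in>grade L a. \<forall>y\<in>grade L b. \<lbrakk>x, y\<rbrakk> \<in> span A"
    using finite_derived_generators[OF dim] by (elim exE conjE)
  have br: "\<lbrakk>x, y\<rbrakk> \<in> span A" if "x \<in> grade L a" "y \<in> grade L b" for a b x y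
    using brA that by simp
  have AL: "A \<subseteq> carrier L" using A grade_closed by blast
  obtain T where T: "finite T" "T \<subseteq> coset ` (grade L 0 \<union> grade L 1)"
    and gen: "\<Inter>{N. sub_superalgebra F quotient N \<and> T \<subseteq> N} = carrier quotient"
    using fg unfolding finitely_generated_def quotient_grade image_Un by blast
  \<comment> \<open>A degree of the quotient is the image of the same degree of \<open>L\<close>, so
    homogeneous generators lift to homogeneous elements.\<close>
  obtain S where S: "finite S" "S \<subseteq> grade L 0 \<union> grade L 1" "T = coset ` S"
    using finite_subset_image[OF T] by blast
  have SL: "S \<subseteq> carrier L" using S grade_closed by blast
  have "\<exists>X. finite X \<and> X \<subseteq> grade L a \<and> (\<forall>q\<in>grade L a. \<exists>x\<in>span X. q \<ominus> x \<in> center L)"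
    (is "\<exists>X. ?P a X") for a
  proof -
    obtain X where X: "finite X" "X \<subseteq> grade L a"
      and Xq: "\<forall>q\<in>grade L a. \<exists>x\<in>span X. \<forall>s\<in>S. \<lbrakk>q \<ominus> x, s\<rbrakk> = \<zero>"
      using finite_codim_centralizer[OF A(1) AL brA S(1,2), where a = a] by (elim exE conjE)
    have "\<exists>x\<in>span X. q \<ominus> x \<in> center L" if q: "q \<in> grade L a" for q
    proof -
      obtain x where x: "x \<in> span X" "\<And>s. s \<in> S \<Longrightarrow> \<lbrakk>q \<ominus> x, s\<rbrakk> = \<zero>" using bspec[OF Xq q] by blast
      \<comment> \<open>The centrality criterion needs \<open>q \<ominus> x\<close> homogeneous,
        hence the choice of \<open>X\<close> inside one degree.\<close>
      have "x \<in> grade L a" using span_is_subset[OF X(2) submodule_grade] x by blast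
      then have "q \<ominus> x \<in> grade L a" using q submodule_minus_closed[OF submodule_grade] by blast
      from central_of_commutes_generators[OF this equalityD1[OF S(3)] SL gen x(2)]
      have "q \<ominus> x \<in> center L" .
      then show ?thesis using x by blast
    qed
    then show ?thesis using X by blast
  qed
  then have "\<forall>a. \<exists>X. ?P a X" ..
  then obtain X where "\<forall>a. ?P a (X a)" unfolding choice_iff ..
  then have X: "finite (X a)" "X a \<subseteq> grade L a"
    and Xq: "q \<in> grade L a \<Longrightarrow> \<exists>x\<in>span (X a). q \<ominus> x \<in> center L" for a q
    by simp_all
  define H where "H = X 0 \<union> X 1 \<union> A"
  have fin: "finite H" and Hg: "H \<subseteq> grade L 0 \<union> grade L 1" using X A by (auto simp: H_def)
  have HL: "H \<subseteq> carrier L" using Hg grade_closed by blast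
  interpret H: submodule F "span H" L by (rule span_is_submodule[OF HL])
  interpret Z: submodule F "center L" L by (rule submodule_center)
  have mono: "span (X 0) \<subseteq> span H" "span (X 1) \<subseteq> span H" "span A \<subseteq> span H"
    by (rule span_is_monotone; auto simp: H_def)+
  \<comment> \<open>Because \<open>A\<close> is part of \<open>H\<close>, the span absorbs all
    brackets of \<open>L\<close>, not only those of its own elements.\<close>
  have brH: "\<lbrakk>x, y\<rbrakk> \<in> span H" if x: "x \<in> carrier L" and y: "y \<in> carrier L" for x y
  proof -
    obtain x0 x1 where xd: "x0 \<in> grade L 0" "x1 \<in> grade L 1" "x = x0 \<oplus> x1" using grade_decomp[OF x] .
    obtain y0 y1 where yd: "y0 \<in> grade L 0" "y1 \<in> grade L 1" "y = y0 \<oplus> y1" using grade_decomp[OF y] .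
    have "\<lbrakk>x, y\<rbrakk> = (\<lbrakk>x0, y0\<rbrakk> \<oplus> \<lbrakk>x1, y0\<rbrakk>) \<oplus> (\<lbrakk>x0, y1\<rbrakk> \<oplus> \<lbrakk>x1, y1\<rbrakk>)"
      using xd yd by (simp add: bracket_add_left bracket_add_right grade_closed bracket_closed)
    also have "\<dots> \<in> span H"
      by (intro H.m_closed subsetD[OF mono(3)] br[OF xd(1) yd(1)] br[OF xd(2) yd(1)]
          br[OF xd(1) yd(2)] br[OF xd(2) yd(2)])
    finally show ?thesis .
  qed
  have "sub_superalgebra F L (span H)"
    using span_is_subspace[OF HL] span_homogeneous_decomp[OF Hg] brH H.subset
    unfolding sub_superalgebra_def by blast
  moreover have "\<exists>k\<in>span H. \<exists>z\<in>center L. l = z \<oplus> k" if l: "l \<in> carrier L" for l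
  proof -
    obtain l0 l1 where ld: "l0 \<in> grade L 0" "l1 \<in> grade L 1" "l = l0 \<oplus> l1" using grade_decomp[OF l] .
    obtain x0 x1 where x: "x0 \<in> span (X 0)" "l0 \<ominus> x0 \<in> center L" "x1 \<in> span (X 1)" "l1 \<ominus> x1 \<in> center L"
      using Xq[OF ld(1)] Xq[OF ld(2)] by blast
    have xH: "x0 \<in> span H" "x1 \<in> span H" using x mono by blast+
    then have carr: "x0 \<in> carrier L" "x1 \<in> carrier L" "l0 \<in> carrier L" "l1 \<in> carrier L"
      using H.subset ld grade_closed by blast+
    have "l = ((l0 \<ominus> x0) \<oplus> (l1 \<ominus> x1)) \<oplus> (x0 \<oplus> x1)"
      using carr by (simp add: ld(3) a_minus_def M.a_ac M.r_neg1 M.r_neg2 M.r_neg M.l_neg)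
    then show ?thesis using Z.m_closed[OF x(2,4)] H.m_closed[OF xH] by blast
  qed
  ultimately show ?thesis using fin HL by blast
qed

text \<open>A span inside a submodule is the same whether computed in the restricted record or in
  \<open>L\<close>, so \<open>H\<close> itself is a finite generating set.\<close>

lemma fin_dim_span:
  assumes "finite H" "H \<subseteq> carrier L"
  shows "vectorspace.fin_dim F (L\<lparr>carrier := span H\<rparr>)"
proof -
  interpret S: vectorspace F "L\<lparr>carrier := span H\<rparr>"
    by (rule subspace_is_vs[OF span_is_subspace[OF assms(2)]])
  show ?thesis
    unfolding S.fin_dim_def
    using assms in_own_span[OF assms(2)] span_li_not_depend(1)[OF in_own_span span_is_submodule]
    by (intro exI[of _ H]) auto
qed

end

theorem theorem4p4:
  fixes F :: "('f, 'm) ring_scheme"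
    and L :: "('f, 'a, 'x) lie_superalgebra_scheme"
    and r s :: nat
  assumes "lie_superalgebra F L"
    and "add_pow F (2::nat) \<one>\<^bsub>F\<^esub> \<noteq> \<zero>\<^bsub>F\<^esub>"
    and "add_pow F (3::nat) \<one>\<^bsub>F\<^esub> \<noteq> \<zero>\<^bsub>F\<^esub>"
    and "finitely_generated F (quotient_superalgebra L (center L))"
    and "has_superdim F (derived F L) r s"
  shows "\<exists>K :: ('f, nat \<Rightarrow> 'f) lie_superalgebra.
           lie_superalgebra F K \<and> vectorspace.fin_dim F K \<and> isoclinic F L K"
proof -
  interpret lie_superalgebra F L by (rule assms(1))
  obtain H where H: "finite H" "H \<subseteq> carrier L" "sub_superalgebra F L (span H)"
    and surj: "\<And>l. l \<in> carrier L \<Longrightarrow> \<exists>k\<in>span H. \<exists>z\<in>center L. l = z \<oplus>\<^bsub>L\<^esub> k"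
    using finite_superalgebra_mod_center[OF assms(4,5)] by blast
  obtain f :: "'a \<Rightarrow> nat \<Rightarrow> 'f" where f: "inj_on f (span H)"
    using inj_on_finite_span[OF H(1,2)] by blast
  note isoclinic_transport[OF assms(1) H(3) f surj]
  then show ?thesis using fin_dim_span[OF H(1,2)] by blast
qed

end
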